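(* Let $\eta\in Z^1_c(Q;\hat V)$ be an essentially bijective cocycle. If $\eta$ is a coboundary, that is, $\eta(q)=q^\flat\xi_0-\xi_0$ for some $\xi_0\in\hat V$, then the homomorphism $H^2(Q;\mathbb T)\to H^2_{\mathrm{pent}}(v;\mathbb T)$, $[c]\mapsto[\theta_c]$, where $$\theta_c(q_1,\xi_1;q_2,\xi_2):=\overline{c(\eta^{-1}((q_2^{-1})^\flat\xi_2)^{-1}\eta^{-1}(\xi_1),\eta^{-1}(\xi_1)^{-1})}\;c(\eta^{-1}(\xi_2)^{-1}\eta^{-1}(q_2^\flat\xi_1),\eta^{-1}(q_2^\flat\xi_1)^{-1}),$$ is injective.
   Context: $Q$ and $V$ are second countable locally compact groups, $V$ is abelian, and $Q$ acts on $V$ through a continuous homomorphism $Q\to\mathrm{Aut}(V)$. $\hat V$ is the Pontryagin dual (written additively) with dual action $q^\flat\xi=\xi\circ q^{-1}$ of $Q$. $Z^1_c(Q;\hat V)$ is the set of continuous maps $\eta\colon Q\to\hat V$ with $\eta(q_1q_2)=\eta(q_1)+q_1^\flat\eta(q_2)$. $\eta$ is essentially bijective if it is a measure class isomorphism $Q\to\hat V$ (with respect to Haar measures; i.e. after removing null sets it is a Borel isomorphism preserving null sets in both directions); $\eta^{-1}$ is its almost everywhere defined inverse. $H^2(Q;\mathbb T)$ is Moore cohomology (Borel $2$-cocycles $c\colon Q\times Q\to\mathbb T$, trivial action, modulo Borel coboundaries). For a standard measure space $X$, a pentagonal transformation is a measure class isomorphism $w\colon X\times X\to X\times X$ with $w_{23}\circ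 w_{13}\circ w_{12}=w_{12}\circ w_{23}$; it defines the unitary $(Uf)(x,y)=J_w(x,y)^{1/2}f(w(x,y))$ on $L^2(X\times X)$ ($J_w$ a Radon--Nikodym derivative), which satisfies $U_{12}U_{13}U_{23}=U_{23}U_{12}$. A measurable $\theta\colon X\times X\to\mathbb T$ is a pentagonal $2$-cocycle for $w$ if $\theta U$ (with $\theta$ acting by multiplication) still satisfies this relation; it is a coboundary if $\theta=\dfrac{f\otimes f}{(f\otimes f)\circ w}$ for a measurable $f\colon X\to\mathbb T$. $H^2_{\mathrm{pent}}(w;\mathbb T)$ is the group of pentagonal $2$-cocycles (identified almost everywhere) modulo coboundaries. Here $X=Q\times\hat V$ and $v$ is the pentagonal transformation $$v(q_1,\xi_1;q_2,\xi_2):=\big(q_2q_1,\ q_2^\flat\xi_1;\ \eta^{-1}(\eta(q_2^{-1})+\xi_1)^{-1}\eta^{-1}(\xi_1),\ (\eta^{-1}(\eta(q_2^{-1})+\xi_1)^{-1})^\flat((q_2^{-1})^\flat\xi_2-\xi_1)\big).$$ It is known that $[c]\mapsto[\theta_c]$ is a well-defined homomorphism $H^2(Q;\mathbb T)\to H^2_{\mathrm{pent}}(v;\mathbb T)$. *)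

theory Defs
  imports "HOL-Analysis.Analysis" "HOL-Algebra.Coset"
begin

text \<open>
  Groups that need not be commutative are instances of \<^class>\<open>topological_group_add\<close>, whose addition
  is not assumed to commute. So the group \<open>Q\<close> of the mathematical text is written additively here:
  \<open>q1 q2\<close> is \<open>q1 + q2\<close> and the inverse of \<open>q\<close> is \<open>- q\<close>.
\<close>

section \<open>The Pontryagin dual\<close>

text \<open>The circle group is the set of complex numbers of modulus 1.\<close>

typedef (overloaded) 'v pdual =
  "{\<xi> :: 'v::topological_ab_group_add \<Rightarrow> complex.
      continuous_on UNIV \<xi> \<and> (\<forall>x. cmod (\<xi> x) = 1) \<and> (\<forall>x y. \<xi> (x + y) = \<xi> x * \<xi> y)}"
  morphisms char_of Abs_pdual
  by (rule exI[of _ "\<lambda>_. 1"]) auto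

setup_lifting type_definition_pdual

instantiation pdual :: (topological_ab_group_add) ab_group_add
begin

lift_definition zero_pdual :: "'a pdual" is "\<lambda>_. 1"
  by auto

lift_definition plus_pdual :: "'a pdual \<Rightarrow> 'a pdual \<Rightarrow> 'a pdual" is "\<lambda>\<xi> \<psi> x. \<xi> x * \<psi> x"
  by (auto intro!: continuous_intros simp: norm_mult)

lift_definition uminus_pdual :: "'a pdual \<Rightarrow> 'a pdual" is "\<lambda>\<xi> x. cnj (\<xi> x)"
  by (auto intro!: continuous_intros)

definition minus_pdual :: "'a pdual \<Rightarrow> 'a pdual \<Rightarrow> 'a pdual" where
  "minus_pdual \<xi> \<psi> = \<xi> + - \<psi>"

instance
proof
  fix a b c :: "'a pdual"
  show "a + b + c = a + (b + c)" by transfer (simp add: mult.assoc)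
  show "a + b = b + a" by transfer (simp add: mult.commute)
  show "0 + a = a" by transfer simp
  show "- a + a = 0"
  proof transfer
    fix a :: "'a \<Rightarrow> complex"
    assume "continuous_on UNIV a \<and> (\<forall>x. cmod (a x) = 1) \<and> (\<forall>x y. a (x + y) = a x * a y)"
    then show "(\<lambda>x. cnj (a x) * a x) = (\<lambda>_. 1)"
      using complex_norm_square by (metis mult.commute of_real_1 power_one)
  qed
  show "a - b = a + - b" by (rule minus_pdual_def)
qed

end

instantiation pdual :: (topological_ab_group_add) topological_space
begin

text \<open>The compact-open topology.\<close>

definition open_pdual :: "'a pdual set \<Rightarrow> bool" where
  "open_pdual = generate_topology {{\<xi>. char_of \<xi> ` K \<subseteq> U} | K U. compact K \<and> open U}"

instance
  by standard (auto simp: open_pdual_def intro: generate_topology.intros)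

end

lemma open_pdual_subbasis:
  fixes K :: "'a::topological_ab_group_add set"
  assumes "compact K" "open U"
  shows "open {\<xi>. char_of \<xi> ` K \<subseteq> U}"
  unfolding open_pdual_def using assms by (auto intro: generate_topology.Basis)

lemma pdual_unif_nhd:
  fixes \<xi> :: "'a::topological_ab_group_add pdual"
  assumes "compact K" "e > 0"
  shows "\<forall>\<^sub>F \<psi> in nhds \<xi>. \<forall>x\<in>K. dist (char_of \<psi> x) (char_of \<xi> x) < e"
proof -
  have cont: "continuous_on UNIV (char_of \<xi>)" using char_of[of \<xi>] by auto
  have "compact (char_of \<xi> ` K)"
    using compact_continuous_image continuous_on_subset[OF cont] assms(1) by blast
  then obtain Z where Z: "finite Z" "char_of \<xi> ` K \<subseteq> (\<Union>z\<in>Z. ball z (e/3))"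
  proof (rule compactE_image[of _ "char_of \<xi> ` K" "\<lambda>z. ball z (e/3)"])
    show "char_of \<xi> ` K \<subseteq> (\<Union>z\<in>char_of \<xi> ` K. ball z (e/3))"
      using assms(2) by force
  qed auto
  define L where "L z = K \<inter> char_of \<xi> -` cball z (e/3)" for z
  have "compact (L z)" for z
    unfolding L_def using closed_vimage[OF _ cont] assms(1) by (intro compact_Int_closed) auto
  then have op: "open {\<psi>. char_of \<psi> ` L z \<subseteq> ball z (e/2)}" for z
    by (intro open_pdual_subbasis) auto
  have mem: "\<xi> \<in> {\<psi>. char_of \<psi> ` L z \<subseteq> ball z (e/2)}" for z
    using assms(2) by (auto simp: L_def)
  have "\<forall>\<^sub>F \<psi> in nhds \<xi>. \<forall>z\<in>Z. char_of \<psi> ` L z \<subseteq> ball z (e/2)"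
    using Z(1) eventually_nhds_in_open[OF op mem] by (simp add: eventually_ball_finite)
  then show ?thesis
  proof eventually_elim
    case (elim \<psi>)
    show ?case
    proof
      fix x assume x: "x \<in> K"
      then obtain z where z: "z \<in> Z" "dist z (char_of \<xi> x) < e/3" using Z(2) by auto
      then have "dist z (char_of \<psi> x) < e/2" using elim x by (force simp: L_def)
      then show "dist (char_of \<psi> x) (char_of \<xi> x) < e"
        using z(2) dist_triangle3[of "char_of \<psi> x" "char_of \<xi> x" z] assms(2) by linarith
    qed
  qed
qed

lemma filterlim_pdual:
  fixes \<xi> :: "'a::topological_ab_group_add pdual"
  assumes "\<And>K e. compact K \<Longrightarrow> e > 0 \<Longrightarrow> \<forall>\<^sub>F p in F. \<forall>x\<in>K. dist (char_of (f p) x) (char_of \<xi> x) < e"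
  shows "(f \<longlongrightarrow> \<xi>) F"
proof (rule topological_tendstoI)
  fix S :: "'a pdual set" assume "open S" "\<xi> \<in> S"
  then show "\<forall>\<^sub>F p in F. f p \<in> S"
    unfolding open_pdual_def
  proof (induction rule: generate_topology.induct)
    case (Basis s)
    then obtain K U where KU: "s = {\<xi>. char_of \<xi> ` K \<subseteq> U}" "compact K" "open U" by auto
    have "compact (char_of \<xi> ` K)"
      using char_of[of \<xi>] KU(2) by (auto intro!: compact_continuous_image intro: continuous_on_subset)
    then obtain e where e: "e > 0" "(\<Union>x\<in>char_of \<xi> ` K. ball x e) \<subseteq> U"
      using compact_subset_open_imp_ball_epsilon_subset[of "char_of \<xi> ` K" U] KU Basis by auto
    show ?case using assms[OF KU(2) e(1)]
      by eventually_elim (use e(2) in \<open>force simp: KU(1) dist_commute\<close>)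
  next
    case (UN K)
    then obtain k where "k \<in> K" "\<xi> \<in> k" by auto
    then show ?case using UN.IH[of k] by (auto elim: eventually_mono)
  qed (auto intro: eventually_conj)
qed

instance pdual :: (topological_ab_group_add) topological_ab_group_add
proof
  fix a b :: "'a pdual"
  show "((\<lambda>x. fst x + snd x) \<longlongrightarrow> a + b) (nhds a \<times>\<^sub>F nhds b)"
  proof (rule filterlim_pdual)
    fix K :: "'a set" and e :: real assume K: "compact K" "e > 0"
    have "\<forall>\<^sub>F p in nhds a \<times>\<^sub>F nhds b.
        (\<forall>x\<in>K. dist (char_of (fst p) x) (char_of a x) < e/2) \<and>
        (\<forall>x\<in>K. dist (char_of (snd p) x) (char_of b x) < e/2)"
    proof (rule eventually_conj)
      show "\<forall>\<^sub>F p in nhds a \<times>\<^sub>F nhds b. \<forall>x\<in>K. dist (char_of (fst p) x) (char_of a x) < e/2"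
        by (rule eventually_compose_filterlim[OF pdual_unif_nhd filterlim_fst]) (use K in auto)
      show "\<forall>\<^sub>F p in nhds a \<times>\<^sub>F nhds b. \<forall>x\<in>K. dist (char_of (snd p) x) (char_of b x) < e/2"
        by (rule eventually_compose_filterlim[OF pdual_unif_nhd filterlim_snd]) (use K in auto)
    qed
    then show "\<forall>\<^sub>F p in nhds a \<times>\<^sub>F nhds b.
        \<forall>x\<in>K. dist (char_of (fst p + snd p) x) (char_of (a + b) x) < e"
    proof eventually_elim
      case (elim p)
      show ?case
      proof
        fix x assume x: "x \<in> K"
        have n: "cmod (char_of (snd p) x) = 1" "cmod (char_of a x) = 1"
          using char_of[of "snd p"] char_of[of a] by auto
        have "char_of (fst p + snd p) x - char_of (a + b) x =
           (char_of (fst p) x - char_of a x) * char_of (snd p) x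
           + char_of a x * (char_of (snd p) x - char_of b x)"
          by (simp add: plus_pdual.rep_eq algebra_simps)
        also have "cmod \<dots> \<le> cmod (char_of (fst p) x - char_of a x)
            + cmod (char_of (snd p) x - char_of b x)"
          by (rule order_trans[OF norm_triangle_ineq]) (simp add: norm_mult n)
        also have "\<dots> < e/2 + e/2"
          using elim x by (intro add_strict_mono) (auto simp: dist_norm)
        finally show "dist (char_of (fst p + snd p) x) (char_of (a + b) x) < e"
          by (simp add: dist_norm)
      qed
    qed
  qed
  show "(uminus \<longlongrightarrow> - a) (nhds a)"
  proof (rule filterlim_pdual)
    fix K :: "'a set" and e :: real assume K: "compact K" "e > 0"
    show "\<forall>\<^sub>F p in nhds a. \<forall>x\<in>K. dist (char_of (- p) x) (char_of (- a) x) < e"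
      using pdual_unif_nhd[OF K, of a]
      by eventually_elim (simp add: dist_norm uminus_pdual.rep_eq flip: complex_cnj_diff)
  qed
qed

instance pdual :: (topological_ab_group_add) t2_space
proof
  fix \<xi> \<psi> :: "'a pdual" assume "\<xi> \<noteq> \<psi>"
  then obtain v where "char_of \<xi> v \<noteq> char_of \<psi> v" by (metis char_of_inject ext)
  from hausdorff[OF this] obtain S T where "open S" "open T" "char_of \<xi> v \<in> S" "char_of \<psi> v \<in> T" "S \<inter> T = {}"
    by auto
  then have "open {\<xi>. char_of \<xi> ` {v} \<subseteq> S} \<and> open {\<xi>. char_of \<xi> ` {v} \<subseteq> T} \<and>
      \<xi> \<in> {\<xi>. char_of \<xi> ` {v} \<subseteq> S} \<and> \<psi> \<in> {\<xi>. char_of \<xi> ` {v} \<subseteq> T} \<and>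
      {\<xi>. char_of \<xi> ` {v} \<subseteq> S} \<inter> {\<xi>. char_of \<xi> ` {v} \<subseteq> T} = {}"
    by (intro conjI open_pdual_subbasis) auto
  then show "\<exists>U V. open U \<and> open V \<and> \<xi> \<in> U \<and> \<psi> \<in> V \<and> U \<inter> V = {}"
    by blast
qed

section \<open>Continuous actions by automorphisms and cocycles\<close>

definition top_automorphisms :: "('v::topological_ab_group_add \<Rightarrow> 'v) set" where
  "top_automorphisms = {\<phi>. bij \<phi> \<and> (\<forall>x y. \<phi> (x + y) = \<phi> x + \<phi> y) \<and>
     continuous_on UNIV \<phi> \<and> continuous_on UNIV (inv_into UNIV \<phi>)}"

text \<open>The Braconnier topology on \<open>Aut(V)\<close>: the compact-open topology for a map and its inverse.\<close>

definition aut_topology :: "('v::topological_ab_group_add \<Rightarrow> 'v) topology" where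
  "aut_topology = topology_generated_by
     ({{\<phi> \<in> top_automorphisms. \<phi> ` K \<subseteq> U} | K U. compact K \<and> open U} \<union>
      {{\<phi> \<in> top_automorphisms. inv_into UNIV \<phi> ` K \<subseteq> U} | K U. compact K \<and> open U})"

definition continuous_action ::
  "('q::topological_group_add \<Rightarrow> 'v::topological_ab_group_add \<Rightarrow> 'v) \<Rightarrow> bool" where
  "continuous_action \<alpha> \<longleftrightarrow>
     continuous_map euclidean aut_topology \<alpha> \<and> (\<forall>q1 q2. \<alpha> (q1 + q2) = \<alpha> q1 \<circ> \<alpha> q2)"

definition dual_act ::
  "('q::topological_group_add \<Rightarrow> 'v::topological_ab_group_add \<Rightarrow> 'v) \<Rightarrow> 'q \<Rightarrow> 'v pdual \<Rightarrow> 'v pdual" where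
  "dual_act \<alpha> q \<xi> = Abs_pdual (char_of \<xi> \<circ> \<alpha> (- q))"

definition cocycles1 ::
  "('q::topological_group_add \<Rightarrow> 'v::topological_ab_group_add \<Rightarrow> 'v) \<Rightarrow> ('q \<Rightarrow> 'v pdual) set" where
  "cocycles1 \<alpha> = {\<eta>. continuous_on UNIV \<eta> \<and>
     (\<forall>q1 q2. \<eta> (q1 + q2) = \<eta> q1 + dual_act \<alpha> q1 (\<eta> q2))}"

section \<open>Haar measure and measure class isomorphisms\<close>

definition haar_measure :: "'g::{topological_group_add, t2_space} measure \<Rightarrow> bool" where
  "haar_measure \<mu> \<longleftrightarrow>
     sets \<mu> = sets borel \<and> emeasure \<mu> UNIV \<noteq> 0 \<and>
     (\<forall>g. \<forall>A\<in>sets borel. emeasure \<mu> ((+) g ` A) = emeasure \<mu> A) \<and>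
     (\<forall>K. compact K \<longrightarrow> emeasure \<mu> K < \<infinity>) \<and>
     (\<forall>A\<in>sets borel. emeasure \<mu> A = (INF U\<in>{U. open U \<and> A \<subseteq> U}. emeasure \<mu> U)) \<and>
     (\<forall>U. open U \<longrightarrow> emeasure \<mu> U = (SUP K\<in>{K. compact K \<and> K \<subseteq> U}. emeasure \<mu> K))"

definition measure_class_iso :: "'a measure \<Rightarrow> 'b measure \<Rightarrow> ('a \<Rightarrow> 'b) \<Rightarrow> bool" where
  "measure_class_iso M N f \<longleftrightarrow> (\<exists>A\<in>null_sets M. \<exists>B\<in>null_sets N.
     bij_betw f (space M - A) (space N - B) \<and>
     f \<in> restrict_space M (space M - A) \<rightarrow>\<^sub>M restrict_space N (space N - B) \<and>
     the_inv_into (space M - A) f \<in> restrict_space N (space N - B) \<rightarrow>\<^sub>M restrict_space M (space M - A) \<and>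
     (\<forall>S\<in>sets M. S \<subseteq> space M - A \<longrightarrow> (S \<in> null_sets M \<longleftrightarrow> f ` S \<in> null_sets N)))"

definition ae_inverse :: "'a measure \<Rightarrow> 'b measure \<Rightarrow> ('a \<Rightarrow> 'b) \<Rightarrow> ('b \<Rightarrow> 'a) \<Rightarrow> bool" where
  "ae_inverse M N f g \<longleftrightarrow>
     g \<in> N \<rightarrow>\<^sub>M M \<and> (AE x in M. g (f x) = x) \<and> (AE y in N. f (g y) = y)"

section \<open>Moore cohomology in degree 2 with coefficients in the circle\<close>

definition moore_Z2 :: "('q::{topological_group_add, t2_space} \<times> 'q \<Rightarrow> complex) monoid" where
  "moore_Z2 = \<lparr>carrier = {c. c \<in> borel_measurable borel \<and> (\<forall>p. cmod (c p) = 1) \<and>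
       (\<forall>q1 q2 q3. c (q1, q2) * c (q1 + q2, q3) = c (q2, q3) * c (q1, q2 + q3))},
     mult = (\<lambda>c d p. c p * d p), one = (\<lambda>_. 1)\<rparr>"

definition moore_B2 :: "('q::{topological_group_add, t2_space} \<times> 'q \<Rightarrow> complex) set" where
  "moore_B2 = {c. \<exists>b \<in> borel_measurable borel. (\<forall>q. cmod (b q) = 1) \<and>
     (\<forall>q1 q2. c (q1, q2) = b q1 * b q2 / b (q1 + q2))}"

definition moore_H2 :: "('q::{topological_group_add, t2_space} \<times> 'q \<Rightarrow> complex) set monoid" where
  "moore_H2 = moore_Z2 Mod moore_B2"

section \<open>Pentagonal cohomology in degree 2\<close>

text \<open>
  \<open>J_w\<close> is the density, with respect to \<open>N\<close>, of the image of \<open>N\<close> under the inverse of \<open>w\<close>. Since \<open>w\<close> is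
  only almost everywhere invertible, this is expressed by pushing forward along \<open>w\<close>.
\<close>

definition jacobian :: "'a measure \<Rightarrow> ('a \<Rightarrow> 'a) \<Rightarrow> 'a \<Rightarrow> real" where
  "jacobian N w = (SOME J. J \<in> borel_measurable N \<and> (\<forall>x. 0 \<le> J x) \<and> distr (density N J) N w = N)"

definition pent_op ::
  "'x measure \<Rightarrow> ('x \<times> 'x \<Rightarrow> 'x \<times> 'x) \<Rightarrow> ('x \<times> 'x \<Rightarrow> complex) \<Rightarrow> 'x \<times> 'x \<Rightarrow> complex" where
  "pent_op M w f p = complex_of_real (sqrt (jacobian (M \<Otimes>\<^sub>M M) w p)) * f (w p)"

definition leg12 :: "(('x \<times> 'x \<Rightarrow> complex) \<Rightarrow> 'x \<times> 'x \<Rightarrow> complex) \<Rightarrow>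
    ('x \<times> 'x \<times> 'x \<Rightarrow> complex) \<Rightarrow> 'x \<times> 'x \<times> 'x \<Rightarrow> complex" where
  "leg12 T F = (\<lambda>(x, y, z). T (\<lambda>(a, b). F (a, b, z)) (x, y))"

definition leg13 :: "(('x \<times> 'x \<Rightarrow> complex) \<Rightarrow> 'x \<times> 'x \<Rightarrow> complex) \<Rightarrow>
    ('x \<times> 'x \<times> 'x \<Rightarrow> complex) \<Rightarrow> 'x \<times> 'x \<times> 'x \<Rightarrow> complex" where
  "leg13 T F = (\<lambda>(x, y, z). T (\<lambda>(a, b). F (a, y, b)) (x, z))"

definition leg23 :: "(('x \<times> 'x \<Rightarrow> complex) \<Rightarrow> 'x \<times> 'x \<Rightarrow> complex) \<Rightarrow>
    ('x \<times> 'x \<times> 'x \<Rightarrow> complex) \<Rightarrow> 'x \<times> 'x \<times> 'x \<Rightarrow> complex" where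
  "leg23 T F = (\<lambda>(x, y, z). T (\<lambda>(a, b). F (x, a, b)) (y, z))"

definition square_integrable :: "'a measure \<Rightarrow> ('a \<Rightarrow> complex) set" where
  "square_integrable N = {F \<in> borel_measurable N. integrable N (\<lambda>x. (cmod (F x))\<^sup>2)}"

text \<open>
  \<open>T12 T13 T23 = T23 T12\<close> on \<open>L\<^sup>2(X\<times>X\<times>X)\<close>. Elements of \<open>L\<^sup>2\<close> are represented by functions, so the identity
  is required almost everywhere.
\<close>

definition pentagon_relation ::
  "'x measure \<Rightarrow> (('x \<times> 'x \<Rightarrow> complex) \<Rightarrow> 'x \<times> 'x \<Rightarrow> complex) \<Rightarrow> bool" where
  "pentagon_relation M T \<longleftrightarrow> (\<forall>F \<in> square_integrable (M \<Otimes>\<^sub>M M \<Otimes>\<^sub>M M).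
     AE p in M \<Otimes>\<^sub>M M \<Otimes>\<^sub>M M. leg12 T (leg13 T (leg23 T F)) p = leg23 T (leg12 T F) p)"

definition pent_Z2 ::
  "'x measure \<Rightarrow> ('x \<times> 'x \<Rightarrow> 'x \<times> 'x) \<Rightarrow> ('x \<times> 'x \<Rightarrow> complex) monoid" where
  "pent_Z2 M w = \<lparr>carrier = {\<theta>. \<theta> \<in> borel_measurable (M \<Otimes>\<^sub>M M) \<and> (\<forall>p. cmod (\<theta> p) = 1) \<and>
       pentagon_relation M (\<lambda>f p. \<theta> p * pent_op M w f p)},
     mult = (\<lambda>\<theta> \<theta>' p. \<theta> p * \<theta>' p), one = (\<lambda>_. 1)\<rparr>"

text \<open>
  The equation holds only almost everywhere, so the quotient by \<open>pent_B2\<close> also identifies cocycles that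
  agree almost everywhere. If \<open>w\<close> is a pentagonal transformation, coboundaries are cocycles, so membership
  in \<open>pent_Z2\<close> is not required.
\<close>

definition pent_B2 ::
  "'x measure \<Rightarrow> ('x \<times> 'x \<Rightarrow> 'x \<times> 'x) \<Rightarrow> ('x \<times> 'x \<Rightarrow> complex) set" where
  "pent_B2 M w = {\<theta> \<in> borel_measurable (M \<Otimes>\<^sub>M M). (\<forall>p. cmod (\<theta> p) = 1) \<and>
     (\<exists>f \<in> borel_measurable M. (\<forall>x. cmod (f x) = 1) \<and>
       (AE p in M \<Otimes>\<^sub>M M. \<theta> p = (f (fst p) * f (snd p)) / (f (fst (w p)) * f (snd (w p)))))}"

definition pent_H2 ::
  "'x measure \<Rightarrow> ('x \<times> 'x \<Rightarrow> 'x \<times> 'x) \<Rightarrow> ('x \<times> 'x \<Rightarrow> complex) set monoid" where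
  "pent_H2 M w = pent_Z2 M w Mod pent_B2 M w"

section \<open>The transformation \<open>v\<close> and the map on cohomology\<close>

text \<open>In the following definitions, \<open>\<zeta>\<close> stands for the almost everywhere defined inverse of \<open>\<eta>\<close>.\<close>

definition pent_v ::
  "('q::topological_group_add \<Rightarrow> 'v::topological_ab_group_add \<Rightarrow> 'v) \<Rightarrow>
   ('q \<Rightarrow> 'v pdual) \<Rightarrow> ('v pdual \<Rightarrow> 'q) \<Rightarrow>
   ('q \<times> 'v pdual) \<times> ('q \<times> 'v pdual) \<Rightarrow> ('q \<times> 'v pdual) \<times> ('q \<times> 'v pdual)" where
  "pent_v \<alpha> \<eta> \<zeta> = (\<lambda>((q1, \<xi>1), (q2, \<xi>2)).
     ((q2 + q1, dual_act \<alpha> q2 \<xi>1),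
      (- \<zeta> (\<eta> (- q2) + \<xi>1) + \<zeta> \<xi>1,
       dual_act \<alpha> (- \<zeta> (\<eta> (- q2) + \<xi>1)) (dual_act \<alpha> (- q2) \<xi>2 - \<xi>1))))"

definition theta ::
  "('q::topological_group_add \<Rightarrow> 'v::topological_ab_group_add \<Rightarrow> 'v) \<Rightarrow> ('v pdual \<Rightarrow> 'q) \<Rightarrow>
   ('q \<times> 'q \<Rightarrow> complex) \<Rightarrow> ('q \<times> 'v pdual) \<times> ('q \<times> 'v pdual) \<Rightarrow> complex" where
  "theta \<alpha> \<zeta> c = (\<lambda>((q1, \<xi>1), (q2, \<xi>2)).
     cnj (c (- \<zeta> (dual_act \<alpha> (- q2) \<xi>2) + \<zeta> \<xi>1, - \<zeta> \<xi>1)) *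
     c (- \<zeta> \<xi>2 + \<zeta> (dual_act \<alpha> q2 \<xi>1), - \<zeta> (dual_act \<alpha> q2 \<xi>1)))"

text \<open>
  The map \<open>[c] \<mapsto> [\<theta>_c]\<close>, by the idiom of \<open>FactGroup_hom\<close>: all \<open>c\<close> in one class have the same \<open>[\<theta>_c]\<close>, and
  that class is the value.
\<close>

definition theta_H2 ::
  "'q::{topological_group_add, t2_space} measure \<Rightarrow> 'v::topological_ab_group_add pdual measure \<Rightarrow>
   ('q \<Rightarrow> 'v \<Rightarrow> 'v) \<Rightarrow> ('q \<Rightarrow> 'v pdual) \<Rightarrow> ('v pdual \<Rightarrow> 'q) \<Rightarrow>
   ('q \<times> 'q \<Rightarrow> complex) set \<Rightarrow> (('q \<times> 'v pdual) \<times> ('q \<times> 'v pdual) \<Rightarrow> complex) set" where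
  "theta_H2 \<mu> \<nu> \<alpha> \<eta> \<zeta> C = the_elem
     ((\<lambda>c. pent_B2 (\<mu> \<Otimes>\<^sub>M \<nu>) (pent_v \<alpha> \<eta> \<zeta>) #>\<^bsub>pent_Z2 (\<mu> \<Otimes>\<^sub>M \<nu>) (pent_v \<alpha> \<eta> \<zeta>)\<^esub> theta \<alpha> \<zeta> c) ` C)"

end

theory Submission
  imports Defs
begin

text \<open>
  Write \<open>\<eta> q = q \<xi>0 - \<xi>0\<close>, so that \<open>q \<mapsto> q \<xi>0\<close> identifies \<open>Q\<close> with the dual of \<open>V\<close> up to null sets. Suppose that
  \<open>\<theta>_c\<close> is the coboundary of \<open>f\<close>. The expression for \<open>\<theta>_c\<close> does not involve the first variable \<open>q1\<close>, which
  forces \<open>f (q, a \<xi>0) = k a m (q\<inverse> a)\<close>. Inserting this, a modification \<open>c'\<close> of \<open>c\<close> by the coboundary of a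
  function built from \<open>k\<close> becomes, as a function on pairs of points of the dual, invariant under the linear action
  of \<open>Q\<close>. Hence the homogeneous cocycle of \<open>c'\<close> is the coboundary of a cochain invariant under the linear
  action, while \<open>c'\<close> itself is invariant under the affine action \<open>\<xi> \<mapsto> q \<xi> + \<eta> q\<close>. The two actions are conjugate by the
  translation by \<open>\<xi>0\<close>, and the cocycle, being invariant under both, is invariant under all translations;
  translating the cochain by \<open>\<xi>0\<close> therefore gives a primitive that is invariant under the affine action, and this
  is a primitive of \<open>c'\<close> on \<open>Q\<close>. In terms of \<open>G = Q \<ltimes> V^\<close>, this says that a class of \<open>G\<close> that is
  trivial on one of the conjugate subgroups \<open>Q\<close> and \<open>\<xi>0 Q \<xi>0\<inverse>\<close> is trivial on the other.

  All identities hold almost everywhere and are written with iterated quantifiers, so that a change of variables only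
  ever requires a nonsingular map in a single variable.
\<close>

section \<open>Topology of the dual\<close>

text \<open>In a Hausdorff space local compactness already provides a neighbourhood base of compact
  sets.\<close>

lemma locally_compact_nbhdE:
  fixes x :: "'a::t2_space"
  assumes "locally_compact_space (euclidean :: 'a topology)" "open U" "x \<in> U"
  obtains W K where "open W" "compact K" "x \<in> W" "W \<subseteq> K" "K \<subseteq> U"
proof -
  have "neighbourhood_base_of (compactin euclidean) (euclidean :: 'a topology)"
    using assms(1) locally_compact_space_neighbourhood_base[of "euclidean :: 'a topology"]
      by (auto simp: Hausdorff_space_def disjnt_def dest!: hausdorff)
  then have "\<exists>W K. open W \<and> compact K \<and> x \<in> W \<and> W \<subseteq> K \<and> K \<subseteq> U"
    using assms(2,3) by (simp add: neighbourhood_base_of flip: open_openin)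
  then show thesis using that by blast
qed

lemma locally_compact_compact_nbhdE:
  fixes C :: "'a::t2_space set"
  assumes "locally_compact_space (euclidean :: 'a topology)" "compact C" "open U" "C \<subseteq> U"
  obtains W K where "open W" "compact K" "C \<subseteq> W" "W \<subseteq> K" "K \<subseteq> U"
proof -
  have "\<forall>x\<in>C. \<exists>W K. open W \<and> compact K \<and> x \<in> W \<and> W \<subseteq> K \<and> K \<subseteq> U"
    using locally_compact_nbhdE[OF assms(1,3)] assms(4) by (metis subsetD)
  then obtain W K where WK: "\<forall>x\<in>C. open (W x) \<and> compact (K x) \<and> x \<in> W x \<and> W x \<subseteq> K x \<and> K x \<subseteq> U"
    by metis
  obtain F where F: "F \<subseteq> C" "finite F" "C \<subseteq> (\<Union>x\<in>F. W x)"
    by (rule compactE_image[OF assms(2), of C W]) (use WK in auto)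
  show thesis
    by (rule that[of "\<Union>x\<in>F. W x" "\<Union>x\<in>F. K x"]) (use F WK in \<open>auto intro!: compact_UN, blast+\<close>)
qed

text \<open>Induction over the generated topology: a family closed under finite intersections is a
  neighbourhood base as soon as it refines the subbasic sets of the compact-open topology.\<close>

lemma open_pdual_subbasis_nbhd:
  assumes "open S" "\<xi> \<in> S"
    and "\<And>K U. compact K \<Longrightarrow> open U \<Longrightarrow> char_of \<xi> ` K \<subseteq> U \<Longrightarrow>
      \<exists>b\<in>B. \<xi> \<in> b \<and> b \<subseteq> {\<psi>. char_of \<psi> ` K \<subseteq> U}"
    and "UNIV \<in> B" and "\<And>a b. a \<in> B \<Longrightarrow> b \<in> B \<Longrightarrow> a \<inter> b \<in> B"
  shows "\<exists>b\<in>B. \<xi> \<in> b \<and> b \<subseteq> S"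
  using assms(1,2) unfolding open_pdual_def
proof (induction rule: generate_topology.induct)
  case UNIV
  show ?case using assms(4) by (intro bexI[of _ UNIV]) auto
next
  case (Int a b)
  then have "\<xi> \<in> a" "\<xi> \<in> b" by auto
  then obtain a' b' where "a' \<in> B" "\<xi> \<in> a'" "a' \<subseteq> a" "b' \<in> B" "\<xi> \<in> b'" "b' \<subseteq> b"
    using Int.IH by meson
  then show ?case by (intro bexI[of _ "a' \<inter> b'"] assms(5)) auto
next
  case (UN K)
  then obtain k where k: "k \<in> K" "\<xi> \<in> k" by auto
  from UN.IH[OF this] obtain b where "b \<in> B" "\<xi> \<in> b" "b \<subseteq> k" by meson
  with k show ?case by (intro bexI[of _ b]) auto
next
  case (Basis s)
  then obtain K U where "s = {\<psi>. char_of \<psi> ` K \<subseteq> U}" "compact K" "open U" by auto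
  then show ?case using Basis assms(3)[of K U] by simp
qed

text \<open>Countably many subbasic sets suffice: cover \<open>K\<close> by finitely many basic sets
  with compact closure, and enclose the image of each closure in a finite union of basic sets inside
  \<open>U\<close>. Local compactness is a hypothesis and not a type class, so the result is an
  existence statement and not a class instance.\<close>

lemma countable_basis_pdual:
  assumes lc: "locally_compact_space (euclidean :: 'v::{topological_ab_group_add, t2_space, second_countable_topology} topology)"
  shows "\<exists>B :: 'v pdual set set. countable B \<and> topological_basis B"
proof -
  obtain A :: "'v set set" where A: "countable A" "topological_basis A"
    using ex_countable_basis by auto
  obtain D :: "complex set set" where D: "countable D" "topological_basis D"
    using ex_countable_basis by auto
  define nb where "nb = (\<lambda>(a :: 'v set, F :: complex set set). {\<xi>. char_of \<xi> ` closure a \<subseteq> \<Union>F})"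
  define SB where "SB = nb ` ({a\<in>A. compact (closure a)} \<times> {F. finite F \<and> F \<subseteq> D})"
  define B where "B = (\<lambda>F. \<Inter>F) ` {F. finite F \<and> F \<subseteq> SB}"
  have "countable SB"
    unfolding SB_def using A(1) D(1) countable_Collect_finite_subset[of D]
    by (intro countable_image countable_SIGMA) auto
  then have "countable B"
    unfolding B_def using countable_Collect_finite_subset[of SB] by (intro countable_image) auto
  have op: "open s" if "s \<in> SB" for s
    using that D(2) unfolding SB_def nb_def
    by (auto intro!: open_pdual_subbasis open_Union dest: topological_basis_open)
  have Int: "a \<inter> b \<in> B" if ab: "a \<in> B" "b \<in> B" for a b
  proof -
    from ab obtain Fa Fb where "finite Fa" "finite Fb" "Fa \<subseteq> SB" "Fb \<subseteq> SB" "a = \<Inter>Fa" "b = \<Inter>Fb"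
      unfolding B_def by auto
    then show ?thesis unfolding B_def by (intro image_eqI[of _ _ "Fa \<union> Fb"]) auto
  qed
  have un: "UNIV \<in> B" unfolding B_def by (intro image_eqI[of _ _ "{}"]) auto
  have sub: "s \<in> B" if "s \<in> SB" for s
    using that unfolding B_def by (intro image_eqI[of _ _ "{s}"]) auto
  have nbhd: "\<exists>b\<in>B. \<xi> \<in> b \<and> b \<subseteq> {\<psi>. char_of \<psi> ` K \<subseteq> U}"
    if KU: "compact K" "open U" "char_of \<xi> ` K \<subseteq> U" for \<xi> :: "'v pdual" and K U
  proof -
    have cont: "continuous_on UNIV (char_of \<xi>)" using char_of[of \<xi>] by auto
    have opU: "open (char_of \<xi> -` U)" using cont KU(2) by (simp add: open_vimage)
    have "\<exists>a\<in>A. x \<in> a \<and> compact (closure a) \<and> char_of \<xi> ` closure a \<subseteq> U" if "x \<in> K" for x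
    proof -
      obtain W L where WL: "open W" "compact L" "x \<in> W" "W \<subseteq> L" "L \<subseteq> char_of \<xi> -` U"
        by (rule locally_compact_nbhdE[OF lc opU, of x]) (use \<open>x \<in> K\<close> KU(3) in auto)
      obtain a where a: "a \<in> A" "x \<in> a" "a \<subseteq> W" using topological_basisE[OF A(2) WL(1,3)] .
      have "closure a \<subseteq> L" using a WL by (intro closure_minimal) (auto intro: compact_imp_closed)
      moreover have "compact (closure a)"
        using calculation WL(2) closed_closure compact_Int_closed[of L "closure a"]
        by (simp add: Int_absorb1)
      ultimately show ?thesis using a WL(5) by blast
    qed
    then obtain a where a: "\<And>x. x \<in> K \<Longrightarrow> a x \<in> A \<and> x \<in> a x \<and> compact (closure (a x)) \<and> char_of \<xi> ` closure (a x) \<subseteq> U"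
      by metis
    obtain Z where Z: "Z \<subseteq> K" "finite Z" "K \<subseteq> (\<Union>x\<in>Z. a x)"
      by (rule compactE_image[OF KU(1), of K a])
        (use a topological_basis_open[OF A(2)] in auto)
    have "\<exists>F. finite F \<and> F \<subseteq> D \<and> char_of \<xi> ` closure (a x) \<subseteq> \<Union>F \<and> \<Union>F \<subseteq> U" if "x \<in> K" for x
    proof -
      have c: "compact (char_of \<xi> ` closure (a x))"
        using a[OF that] cont by (intro compact_continuous_image continuous_on_subset[OF cont]) auto
      have "\<exists>d\<in>D. y \<in> d \<and> d \<subseteq> U" if "y \<in> U" for y
        using topological_basisE[OF D(2) KU(2) that] by metis
      then have "char_of \<xi> ` closure (a x) \<subseteq> \<Union>{d\<in>D. d \<subseteq> U}"
        using a[OF that] by blast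
      then obtain F where "F \<subseteq> {d\<in>D. d \<subseteq> U}" "finite F" "char_of \<xi> ` closure (a x) \<subseteq> \<Union>F"
        using compactE[OF c, of "{d\<in>D. d \<subseteq> U}"] topological_basis_open[OF D(2)] by auto
      then show ?thesis by (intro exI[of _ F]) auto
    qed
    then obtain F where F: "\<And>x. x \<in> K \<Longrightarrow> finite (F x) \<and> F x \<subseteq> D \<and> char_of \<xi> ` closure (a x) \<subseteq> \<Union>(F x) \<and> \<Union>(F x) \<subseteq> U"
      by metis
    have *: "nb (a x, F x) \<in> SB" if "x \<in> Z" for x
      unfolding SB_def using that Z(1) a[of x] F[of x] by (intro imageI) blast
    have **: "nb (a x, F x) = {\<psi>. char_of \<psi> ` closure (a x) \<subseteq> \<Union>(F x)}" for x
      by (simp add: nb_def)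
    show ?thesis
    proof (intro bexI[of _ "\<Inter>((\<lambda>x. nb (a x, F x)) ` Z)"] conjI)
      show "\<Inter>((\<lambda>x. nb (a x, F x)) ` Z) \<in> B"
        unfolding B_def using * Z(2) by (intro imageI) auto
      show "\<xi> \<in> \<Inter>((\<lambda>x. nb (a x, F x)) ` Z)"
        using F Z(1) unfolding ** by blast
      show "\<Inter>((\<lambda>x. nb (a x, F x)) ` Z) \<subseteq> {\<psi>. char_of \<psi> ` K \<subseteq> U}"
      proof safe
        fix \<psi> y assume \<psi>: "\<psi> \<in> \<Inter>((\<lambda>x. nb (a x, F x)) ` Z)" and y: "y \<in> K"
        then obtain x where x: "x \<in> Z" "y \<in> a x" using Z(3) by auto
        then have "y \<in> closure (a x)" using closure_subset by blast
        then show "char_of \<psi> y \<in> U" using \<psi> x F[of x] Z(1) unfolding ** by blast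
      qed
    qed
  qed
  have "topological_basis B"
  proof (rule topological_basisI)
    show "open b" if "b \<in> B" for b
      using that op unfolding B_def by (auto intro!: open_Inter)
    show "\<exists>b\<in>B. \<xi> \<in> b \<and> b \<subseteq> S" if "open S" "\<xi> \<in> S" for S and \<xi> :: "'v pdual"
      by (rule open_pdual_subbasis_nbhd[OF that]) (fact nbhd un Int)+
  qed
  with \<open>countable B\<close> show ?thesis by blast
qed

section \<open>The dual action\<close>

lemma continuous_action_automorphism:
  assumes "continuous_action \<alpha>"
  shows "\<alpha> q \<in> top_automorphisms"
proof -
  have "\<alpha> q \<in> topspace aut_topology"
    using assms unfolding continuous_action_def continuous_map_def by auto
  then show ?thesis unfolding aut_topology_def topology_generated_by_topspace by auto
qed

lemma continuous_action_add: "continuous_action \<alpha> \<Longrightarrow> \<alpha> (p + q) x = \<alpha> p (\<alpha> q x)"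
  by (simp add: continuous_action_def)

lemma continuous_action_zero:
  assumes "continuous_action \<alpha>"
  shows "\<alpha> 0 x = x"
proof -
  have "inj (\<alpha> 0)" using continuous_action_automorphism[OF assms] by (auto simp: top_automorphisms_def bij_def)
  then show ?thesis using continuous_action_add[OF assms, of 0 0 x] by (simp add: inj_eq)
qed

lemma open_continuous_action:
  assumes "continuous_action \<alpha>" "compact K" "open U"
  shows "open {q. \<alpha> q ` K \<subseteq> U}"
proof -
  have "openin aut_topology {\<phi> \<in> top_automorphisms. \<phi> ` K \<subseteq> U}"
    unfolding aut_topology_def using assms(2,3) by (intro topology_generated_by_Basis) blast
  then have "openin euclidean {q \<in> topspace euclidean. \<alpha> q \<in> {\<phi> \<in> top_automorphisms. \<phi> ` K \<subseteq> U}}"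
    using assms(1) unfolding continuous_action_def by (intro openin_continuous_map_preimage) auto
  then show ?thesis
    using continuous_action_automorphism[OF assms(1)] by (simp flip: open_openin)
qed

lemma char_of_dual_act:
  assumes "continuous_action \<alpha>"
  shows "char_of (dual_act \<alpha> q \<xi>) x = char_of \<xi> (\<alpha> (- q) x)"
proof -
  have "\<alpha> (- q) \<in> top_automorphisms" by (rule continuous_action_automorphism[OF assms])
  then have "char_of (dual_act \<alpha> q \<xi>) = char_of \<xi> \<circ> \<alpha> (- q)"
    unfolding dual_act_def using char_of[of \<xi>]
    by (intro Abs_pdual_inverse)
       (auto simp: top_automorphisms_def intro: continuous_on_compose2[of UNIV])
  then show ?thesis by simp
qed

lemma pdual_eqI: "(\<And>x. char_of \<xi> x = char_of \<psi> x) \<Longrightarrow> \<xi> = \<psi>"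
  by (metis char_of_inject ext)

lemma dual_act_add:
  "continuous_action \<alpha> \<Longrightarrow> dual_act \<alpha> (p + q) \<xi> = dual_act \<alpha> p (dual_act \<alpha> q \<xi>)"
  by (rule pdual_eqI) (simp add: char_of_dual_act minus_add continuous_action_add
      del: add_uminus_conv_diff)

lemma dual_act_zero: "continuous_action \<alpha> \<Longrightarrow> dual_act \<alpha> 0 \<xi> = \<xi>"
  by (rule pdual_eqI) (simp add: char_of_dual_act continuous_action_zero)

lemma dual_act_plus:
  "continuous_action \<alpha> \<Longrightarrow> dual_act \<alpha> q (\<xi> + \<psi>) = dual_act \<alpha> q \<xi> + dual_act \<alpha> q \<psi>"
  by (rule pdual_eqI) (simp add: char_of_dual_act plus_pdual.rep_eq)

lemma continuous_dual_act:
  fixes \<alpha> :: "'q::topological_group_add \<Rightarrow> 'v::{topological_ab_group_add, t2_space} \<Rightarrow> 'v"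
  assumes lc: "locally_compact_space (euclidean :: 'v topology)" and \<alpha>: "continuous_action \<alpha>"
  shows "continuous_on UNIV (\<lambda>p. dual_act \<alpha> (fst p) (snd p))"
proof (rule continuous_on_generate_topology[of "{{\<xi>. char_of \<xi> ` K \<subseteq> U} | K U. compact K \<and> open U}"])
  show "open = generate_topology {{\<xi> :: 'v pdual. char_of \<xi> ` K \<subseteq> U} | K U. compact K \<and> open U}"
    by (simp add: open_pdual_def)
  fix B :: "'v pdual set" assume "B \<in> {{\<xi>. char_of \<xi> ` K \<subseteq> U} | K U. compact K \<and> open U}"
  then obtain K U where B: "B = {\<xi>. char_of \<xi> ` K \<subseteq> U}" "compact K" "open U" by auto
  have "open ((\<lambda>p. dual_act \<alpha> (fst p) (snd p)) -` B)"
  proof (subst open_subopen, rule ballI)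
    fix p :: "'q \<times> 'v pdual"
    obtain q0 \<xi>0 where p: "p = (q0, \<xi>0)" by fastforce
    assume "p \<in> (\<lambda>p. dual_act \<alpha> (fst p) (snd p)) -` B"
    then have sub: "\<alpha> (- q0) ` K \<subseteq> char_of \<xi>0 -` U"
      by (auto simp: p B(1) char_of_dual_act[OF \<alpha>])
    have "continuous_on UNIV (\<alpha> (- q0))"
      using continuous_action_automorphism[OF \<alpha>, of "- q0"] by (auto simp: top_automorphisms_def)
    then have "compact (\<alpha> (- q0) ` K)"
      using B(2) by (intro compact_continuous_image) (auto intro: continuous_on_subset)
    moreover have "open (char_of \<xi>0 -` U)" using char_of[of \<xi>0] B(3) by (auto intro: open_vimage)
    ultimately obtain W L where WL: "open W" "compact L" "\<alpha> (- q0) ` K \<subseteq> W" "W \<subseteq> L" "L \<subseteq> char_of \<xi>0 -` U"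
      using locally_compact_compact_nbhdE[OF lc _ _ sub] by metis
    have "open (uminus -` {q. \<alpha> q ` K \<subseteq> W})"
      by (intro open_vimage open_continuous_action[OF \<alpha> B(2) WL(1)] continuous_intros)
    then have "open ((uminus -` {q. \<alpha> q ` K \<subseteq> W}) \<times> {\<xi>. char_of \<xi> ` L \<subseteq> U})"
      by (intro open_Times open_pdual_subbasis WL(2) B(3))
    moreover have "p \<in> (uminus -` {q. \<alpha> q ` K \<subseteq> W}) \<times> {\<xi>. char_of \<xi> ` L \<subseteq> U}"
      using WL by (auto simp: p)
    moreover have "(uminus -` {q. \<alpha> q ` K \<subseteq> W}) \<times> {\<xi>. char_of \<xi> ` L \<subseteq> U}
        \<subseteq> (\<lambda>p. dual_act \<alpha> (fst p) (snd p)) -` B"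
      using WL(4) by (force simp: B(1) char_of_dual_act[OF \<alpha>])
    ultimately show "\<exists>T. open T \<and> p \<in> T \<and> T \<subseteq> (\<lambda>p. dual_act \<alpha> (fst p) (snd p)) -` B"
      by blast
  qed
  then show "\<exists>C. open C \<and> C \<inter> UNIV = (\<lambda>p. dual_act \<alpha> (fst p) (snd p)) -` B \<inter> UNIV" by auto
qed

section \<open>Haar measures on groups with a countable basis\<close>

text \<open>Countable bases make every open subset of the product a countable union of open
  rectangles, hence measurable for the product sigma-algebra.\<close>

lemma measurable_continuous_prod:
  assumes "\<exists>A :: 'a::topological_space set set. countable A \<and> topological_basis A"
    and "\<exists>B :: 'b::topological_space set set. countable B \<and> topological_basis B"
    and f: "continuous_on UNIV (f :: 'a \<times> 'b \<Rightarrow> 'c::topological_space)"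
  shows "f \<in> borel \<Otimes>\<^sub>M borel \<rightarrow>\<^sub>M borel"
proof (rule borel_measurableI)
  fix S :: "'c set" assume "open S"
  obtain A :: "'a set set" and B :: "'b set set"
    where AB: "countable A" "topological_basis A" "countable B" "topological_basis B"
    using assms(1,2) by blast
  have "open (f -` S)" using f \<open>open S\<close> by (rule open_vimage[rotated])
  then obtain C where C: "C \<subseteq> (\<lambda>(a, b). a \<times> b) ` (A \<times> B)" "\<Union>C = f -` S"
    using topological_basis_prod[OF AB(2,4)] unfolding topological_basis_def by metis
  have "countable C"
    by (rule countable_subset[OF C(1)]) (use AB in auto)
  moreover have "c \<in> sets (borel \<Otimes>\<^sub>M borel)" if "c \<in> C" for c
  proof -
    obtain a b where "a \<in> A" "b \<in> B" "c = a \<times> b" using \<open>c \<in> C\<close> C(1) by auto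
    then show ?thesis
      using AB(2,4) topological_basis_open by (metis borel_open pair_measureI)
  qed
  ultimately have "\<Union>C \<in> sets (borel \<Otimes>\<^sub>M borel)" by blast
  then show "f -` S \<inter> space (borel \<Otimes>\<^sub>M borel) \<in> sets (borel \<Otimes>\<^sub>M borel)"
    by (simp add: C(2) space_pair_measure)
qed

lemma open_translate:
  fixes U :: "'g::topological_group_add set"
  assumes "open U"
  shows "open ((+) g ` U)"
proof -
  have "(+) g ` U = (\<lambda>x. - g + x) -` U"
    by (auto simp: image_iff add.assoc[symmetric] intro!: bexI[of _ "- g + _"])
  then show ?thesis using assms by (auto intro!: open_vimage continuous_intros)
qed

text \<open>Inner regularity gives a compact set of nonzero measure, and outer regularity a nonempty
  open set of finite measure around it. Its translates cover the group, so the basic sets of finite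
  measure do too.\<close>

lemma haar_measure_sigma_finite:
  fixes \<mu> :: "'g::{topological_group_add, t2_space} measure"
  assumes basis: "\<exists>B :: 'g set set. countable B \<and> topological_basis B" and \<mu>: "haar_measure \<mu>"
  shows "sigma_finite_measure \<mu>"
proof -
  have sets: "sets \<mu> = sets borel" and sp: "space \<mu> = UNIV"
    using \<mu> by (auto simp: haar_measure_def dest: sets_eq_imp_space_eq)
  have "emeasure \<mu> UNIV = (SUP K\<in>{K. compact K \<and> K \<subseteq> UNIV}. emeasure \<mu> K)" "emeasure \<mu> UNIV \<noteq> 0"
    using \<mu> open_UNIV unfolding haar_measure_def by blast+
  then obtain K :: "'g set" where K: "compact K" "emeasure \<mu> K \<noteq> 0"
    by (metis (mono_tags, lifting) SUP_least le_zero_eq order_refl mem_Collect_eq)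
  then have "(INF U\<in>{U. open U \<and> K \<subseteq> U}. emeasure \<mu> U) < \<infinity>"
    using \<mu> borel_compact[OF K(1)] unfolding haar_measure_def by metis
  then obtain U where U: "open U" "K \<subseteq> U" "emeasure \<mu> U < \<infinity>"
    by (auto simp: INF_less_iff)
  then obtain u where u: "u \<in> U" using K(2) by fastforce
  have fin: "emeasure \<mu> ((+) g ` U) < \<infinity>" for g
    using \<mu> U unfolding haar_measure_def by simp
  obtain B :: "'g set set" where B: "countable B" "topological_basis B" using basis by blast
  define C where "C = {b\<in>B. emeasure \<mu> b < \<infinity>}"
  have "x \<in> \<Union>C" for x
  proof -
    have "x \<in> (+) (x + - u) ` U" using u by (intro image_eqI[of _ _ u]) (auto simp: add.assoc)
    then obtain b where b: "b \<in> B" "x \<in> b" "b \<subseteq> (+) (x + - u) ` U"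
      using topological_basisE[OF B(2) open_translate[OF U(1)]] by metis
    have "emeasure \<mu> b \<le> emeasure \<mu> ((+) (x + - u) ` U)"
      using b U(1) by (intro emeasure_mono) (auto simp: sets open_translate)
    then show ?thesis using b fin[of "x + - u"] by (auto simp: C_def intro: le_less_trans)
  qed
  moreover have "countable C" by (rule countable_subset[OF _ B(1)]) (auto simp: C_def)
  moreover have "C \<subseteq> sets \<mu>"
    unfolding C_def sets by (auto intro: borel_open topological_basis_open[OF B(2)])
  moreover have "\<forall>a\<in>C. emeasure \<mu> a \<noteq> \<infinity>" by (simp add: C_def less_top)
  ultimately show ?thesis
    unfolding sigma_finite_measure_def by (intro exI[of _ C]) (auto simp: sp)
qed

section \<open>Measurable groups\<close>

text \<open>These are the properties of a Haar measure on a second countable group from which the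
  measure theory below is derived; the topology no longer appears.\<close>

locale measurable_group = sigma_finite_measure \<mu> for \<mu> :: "'g::group_add measure" +
  assumes space_UNIV [simp]: "space \<mu> = UNIV"
    and add_measurable: "(\<lambda>p. fst p + snd p) \<in> \<mu> \<Otimes>\<^sub>M \<mu> \<rightarrow>\<^sub>M \<mu>"
    and uminus_measurable: "uminus \<in> \<mu> \<rightarrow>\<^sub>M \<mu>"
    and emeasure_nonzero: "emeasure \<mu> UNIV \<noteq> 0"
    and emeasure_translate: "A \<in> sets \<mu> \<Longrightarrow> emeasure \<mu> ((+) g ` A) = emeasure \<mu> A"
begin

lemma measurable_add [measurable (raw)]:
  assumes [measurable]: "f \<in> N \<rightarrow>\<^sub>M \<mu>" "g \<in> N \<rightarrow>\<^sub>M \<mu>"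
  shows "(\<lambda>x. f x + g x) \<in> N \<rightarrow>\<^sub>M \<mu>"
  using measurable_compose[OF measurable_Pair[OF assms] add_measurable] by simp

lemma measurable_neg [measurable (raw)]: "f \<in> N \<rightarrow>\<^sub>M \<mu> \<Longrightarrow> (\<lambda>x. - f x) \<in> N \<rightarrow>\<^sub>M \<mu>"
  using uminus_measurable by (rule measurable_compose[rotated])

lemma measurable_minus [measurable (raw)]:
  assumes "f \<in> N \<rightarrow>\<^sub>M \<mu>" "g \<in> N \<rightarrow>\<^sub>M \<mu>"
  shows "(\<lambda>x. f x - g x) \<in> N \<rightarrow>\<^sub>M \<mu>"
  using measurable_add[OF assms(1) measurable_neg[OF assms(2)]] by simp

lemma pair_sigma_finite_self: "pair_sigma_finite \<mu> \<mu>"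
  by (rule pair_sigma_finite.intro) unfold_locales

text \<open>The measure is nonzero. This is how generic base points are chosen throughout.\<close>

lemma AE_ex: "AE x in \<mu>. P x \<Longrightarrow> \<exists>x. P x"
proof (rule ccontr)
  assume "AE x in \<mu>. P x" "\<nexists>x. P x"
  then have "AE x in \<mu>. False" by simp
  then show False
    using emeasure_nonzero null_sets_subset[of _ \<mu> UNIV] sets.top[of \<mu>]
    by (auto simp: eventually_ae_filter space_UNIV top.extremum_unique)
qed

lemma AE_add_left:
  assumes "AE x in \<mu>. P x"
  shows "AE x in \<mu>. P (g + x)"
proof -
  obtain N where N: "N \<in> null_sets \<mu>" "{x \<in> space \<mu>. \<not> P x} \<subseteq> N"
    using assms by (auto simp: eventually_ae_filter)
  have eq: "(+) (- g) ` N = (\<lambda>x. g + x) -` N \<inter> space \<mu>"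
    by (force simp: space_UNIV image_iff add.assoc[symmetric] intro: bexI[of _ "g + _"])
  have "(\<lambda>x. g + x) -` N \<inter> space \<mu> \<in> sets \<mu>"
  proof (rule measurable_sets)
    show "(\<lambda>x. g + x) \<in> \<mu> \<rightarrow>\<^sub>M \<mu>" by (rule measurable_add) (simp_all add: space_UNIV)
  qed (use N(1) in auto)
  then have "(+) (- g) ` N \<in> null_sets \<mu>"
    using N(1) emeasure_translate[of N "- g"] by (auto simp: null_sets_def eq)
  then show ?thesis
    by (rule AE_I') (use N(2) in \<open>auto simp: eq space_UNIV\<close>)
qed

text \<open>Fubini replaces the modular function: \<open>- y + x\<close> avoids the null set for
  every \<open>y\<close> and almost every \<open>x\<close>, hence for some \<open>x\<close> and
  almost every \<open>y\<close>. Left translation of \<open>y\<close> by \<open>x\<close> then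
  leaves \<open>- y\<close>.\<close>

lemma AE_minus:
  assumes "AE x in \<mu>. P x"
  shows "AE x in \<mu>. P (- x)"
proof -
  interpret pair_sigma_finite \<mu> \<mu> by (rule pair_sigma_finite_self)
  obtain N where N: "N \<in> null_sets \<mu>" "{x \<in> space \<mu>. \<not> P x} \<subseteq> N"
    using assms by (auto simp: eventually_ae_filter)
  have [measurable]: "N \<in> sets \<mu>" using N(1) by auto
  have "AE y in \<mu>. AE x in \<mu>. - y + x \<notin> N"
    by (intro AE_I2 AE_add_left AE_not_in N(1))
  then have "AE x in \<mu>. AE y in \<mu>. - y + x \<notin> N"
    by (subst (asm) AE_commute) measurable
  then obtain x where "AE y in \<mu>. - y + x \<notin> N" using AE_ex by blast
  then have "AE y in \<mu>. - (x + y) + x \<notin> N" by (rule AE_add_left)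
  then show ?thesis
    by eventually_elim (use N(2) in \<open>auto simp: space_UNIV minus_add add.assoc simp del: add_uminus_conv_diff\<close>)
qed

text \<open>Right translation is left translation conjugated by inversion.\<close>

lemma AE_add_right:
  assumes "AE x in \<mu>. P x"
  shows "AE x in \<mu>. P (x + g)"
proof -
  have "AE x in \<mu>. P (- (- g + - x))"
    by (rule AE_minus[OF AE_add_left[OF AE_minus[OF assms]]])
  then show ?thesis by (simp add: minus_add del: add_uminus_conv_diff)
qed

text \<open>Fubini twice: exchange the two inner variables first, then the outer one with the
  resulting pair.\<close>

lemma AE_rotate3:
  assumes P: "Measurable.pred (\<mu> \<Otimes>\<^sub>M \<mu> \<Otimes>\<^sub>M \<mu>) (\<lambda>t. P (fst t) (fst (snd t)) (snd (snd t)))"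
    and ae: "AE x in \<mu>. AE y in \<mu>. AE z in \<mu>. P x y z"
  shows "AE z in \<mu>. AE y in \<mu>. AE x in \<mu>. P x y z"
proof -
  interpret P: pair_sigma_finite \<mu> \<mu> by (rule pair_sigma_finite_self)
  interpret Q: pair_sigma_finite \<mu> "\<mu> \<Otimes>\<^sub>M \<mu>"
    by (intro pair_sigma_finite.intro sigma_finite_pair_measure) unfold_locales
  have c: "(\<lambda>p. (x, fst p, snd p)) \<in> \<mu> \<Otimes>\<^sub>M \<mu> \<rightarrow>\<^sub>M \<mu> \<Otimes>\<^sub>M \<mu> \<Otimes>\<^sub>M \<mu>"
    "(\<lambda>p. (x, snd p, fst p)) \<in> \<mu> \<Otimes>\<^sub>M \<mu> \<rightarrow>\<^sub>M \<mu> \<Otimes>\<^sub>M \<mu> \<Otimes>\<^sub>M \<mu>"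
    "(\<lambda>p. (fst p, snd (snd p), fst (snd p))) \<in> \<mu> \<Otimes>\<^sub>M \<mu> \<Otimes>\<^sub>M \<mu> \<rightarrow>\<^sub>M \<mu> \<Otimes>\<^sub>M \<mu> \<Otimes>\<^sub>M \<mu>" for x
    by (auto intro!: measurable_Pair simp: space_UNIV)
  have [measurable]: "Measurable.pred (\<mu> \<Otimes>\<^sub>M \<mu>) (\<lambda>p. P x (fst p) (snd p))"
    "Measurable.pred (\<mu> \<Otimes>\<^sub>M \<mu>) (\<lambda>p. P x (snd p) (fst p))"
    "Measurable.pred (\<mu> \<Otimes>\<^sub>M \<mu> \<Otimes>\<^sub>M \<mu>) (\<lambda>p. P (fst p) (snd (snd p)) (fst (snd p)))" for x
    using measurable_compose[OF c(1) P] measurable_compose[OF c(2) P] measurable_compose[OF c(3) P]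
    by simp_all
  have "AE x in \<mu>. AE z in \<mu>. AE y in \<mu>. P x y z"
    using ae by eventually_elim (subst (asm) P.AE_commute, measurable)
  then have "AE x in \<mu>. AE p in \<mu> \<Otimes>\<^sub>M \<mu>. P x (snd p) (fst p)"
  proof eventually_elim
    case (elim x)
    have "{p \<in> space (\<mu> \<Otimes>\<^sub>M \<mu>). P x (snd p) (fst p)} \<in> sets (\<mu> \<Otimes>\<^sub>M \<mu>)" by measurable
    then show ?case using elim by (intro P.AE_pair_measure) simp_all
  qed
  then have "AE p in \<mu> \<Otimes>\<^sub>M \<mu>. AE x in \<mu>. P x (snd p) (fst p)"
    by (subst (asm) Q.AE_commute) measurable
  from P.AE_pair[OF this] show ?thesis by simp
qed

text \<open>
  A cocycle that is trivial almost everywhere satisfies \<open>e (x + y, z) = e (y, z)\<close> for almost all \<open>x, y\<close>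
  and each \<open>z\<close>, so that \<open>e (-, z)\<close> is essentially constant; its essential value is a primitive of \<open>e\<close>.
\<close>

lemma AE_trivial_cocycle_imp_coboundary:
  fixes e :: "'g \<times> 'g \<Rightarrow> complex"
  assumes [measurable]: "e \<in> borel_measurable (\<mu> \<Otimes>\<^sub>M \<mu>)" and norm: "\<And>p. cmod (e p) = 1"
    and coc: "\<And>x y z. e (x, y) * e (x + y, z) = e (y, z) * e (x, y + z)"
    and ae: "AE y in \<mu>. AE x in \<mu>. e (x, y) = 1"
  shows "\<exists>b \<in> borel_measurable \<mu>. (\<forall>q. cmod (b q) = 1) \<and> (\<forall>x y. e (x, y) = b x * b y / b (x + y))"
proof -
  have [measurable]: "(\<lambda>x. e (x, z)) \<in> borel_measurable \<mu>" for z
    by (rule measurable_compose[OF measurable_Pair2' assms(1)]) (simp add: space_UNIV)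
  have const: "\<exists>w. AE x in \<mu>. e (x, z) = w" for z
  proof -
    have "AE y in \<mu>. AE x in \<mu>. e (x, y + z) = 1" by (rule AE_add_right[OF ae])
    with ae have "AE y in \<mu>. AE x in \<mu>. e (x + y, z) = e (y, z)"
    proof eventually_elim
      case (elim y)
      then show ?case
        by eventually_elim (metis coc mult_1 mult.right_neutral)
    qed
    \<comment> \<open>One generic \<open>y\<close> suffices; right translation by \<open>- y\<close>
      gives a statement about \<open>e (x, z)\<close>.\<close>
    then obtain y where "AE x in \<mu>. e (x + y, z) = e (y, z)" using AE_ex by blast
    from AE_add_right[OF this, of "- y"] show ?thesis by (auto simp: add.assoc)
  qed
  \<comment> \<open>Averaging over a set of positive finite measure selects the essential value as a
    measurable function of \<open>z\<close>.\<close>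
  obtain A where A: "A \<in> sets \<mu>" "emeasure \<mu> A \<noteq> 0" "emeasure \<mu> A < \<infinity>"
  proof -
    obtain F :: "nat \<Rightarrow> 'g set" where F: "range F \<subseteq> sets \<mu>" "(\<Union>i. F i) = UNIV" "\<And>i. emeasure \<mu> (F i) \<noteq> \<infinity>"
      using sigma_finite space_UNIV by metis
    have "\<exists>i. emeasure \<mu> (F i) \<noteq> 0"
    proof (rule ccontr)
      assume "\<nexists>i. emeasure \<mu> (F i) \<noteq> 0"
      then have "(\<Union>i. F i) \<in> null_sets \<mu>" using F(1) by (intro null_sets_UN) auto
      then show False using emeasure_nonzero F(2) by auto
    qed
    then obtain i where "emeasure \<mu> (F i) \<noteq> 0" ..
    then show ?thesis using that[of "F i"] F by (auto simp: less_top)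
  qed
  have mA: "measure \<mu> A > 0" using A by (simp add: measure_def enn2real_positive_iff zero_less_iff_neq_zero)
  define b where "b z = (LINT x|\<mu>. indicator A x *\<^sub>R e (x, z)) / measure \<mu> A" for z
  have b: "AE x in \<mu>. e (x, z) = b z" for z
  proof -
    from const obtain w where w: "AE x in \<mu>. e (x, z) = w" by blast
    then have "(LINT x|\<mu>. indicator A x *\<^sub>R e (x, z)) = (LINT x|\<mu>. indicator A x *\<^sub>R w)"
      using A(1) by (intro integral_cong_AE) (measurable, auto)
    also have "\<dots> = measure \<mu> A *\<^sub>R w" using A by (simp add: space_UNIV)
    finally have "b z = w" using mA by (simp add: b_def scaleR_conv_of_real)
    with w show ?thesis by simp
  qed
  have nb: "cmod (b z) = 1" for z
    using AE_ex[OF b[of z]] norm by metis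
  have "e (y, z) = b y * b z / b (y + z)" for y z
  proof -
    \<comment> \<open>A common generic \<open>x\<close> for all three essential values turns the
      cocycle identity, which holds everywhere, into the claim for every \<open>y\<close> and
      \<open>z\<close>.\<close>
    have "AE x in \<mu>. e (x, y) = b y \<and> e (x + y, z) = b z \<and> e (x, y + z) = b (y + z)"
      using b[of y] AE_add_right[OF b[of z], of y] b[of "y + z"] by eventually_elim simp
    then obtain x where "e (x, y) = b y" "e (x + y, z) = b z" "e (x, y + z) = b (y + z)"
      using AE_ex by blast
    then have "b y * b z = e (y, z) * b (y + z)" using coc[of x y z] by simp
    moreover have "b (y + z) \<noteq> 0" using nb[of "y + z"] by auto
    ultimately show ?thesis by simp
  qed
  moreover have "b \<in> borel_measurable \<mu>" unfolding b_def using A(1) by measurable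
  ultimately show ?thesis using nb by blast
qed

end

lemma haar_measurable_group:
  fixes \<mu> :: "'g::{topological_group_add, t2_space} measure"
  assumes basis: "\<exists>B :: 'g set set. countable B \<and> topological_basis B" and \<mu>: "haar_measure \<mu>"
  shows "measurable_group \<mu>"
proof -
  interpret sigma_finite_measure \<mu> by (rule haar_measure_sigma_finite[OF assms])
  have sets [measurable_cong]: "sets \<mu> = sets borel" using \<mu> by (simp add: haar_measure_def)
  show ?thesis
  proof
    show "space \<mu> = UNIV" using sets_eq_imp_space_eq[OF sets] by simp
    show "(\<lambda>p. fst p + snd p) \<in> \<mu> \<Otimes>\<^sub>M \<mu> \<rightarrow>\<^sub>M \<mu>"
      using measurable_continuous_prod[OF basis basis, of "\<lambda>p. fst p + snd p"]
      by (simp add: continuous_intros cong: measurable_cong_sets sets_pair_measure_cong add: sets)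
    show "uminus \<in> \<mu> \<rightarrow>\<^sub>M \<mu>"
      using borel_measurable_continuous_onI[of "uminus :: 'g \<Rightarrow> 'g"]
      by (simp add: continuous_intros cong: measurable_cong_sets add: sets)
  qed (use \<mu> in \<open>auto simp: haar_measure_def\<close>)
qed

section \<open>Essentially free and transitive orbits\<close>

text \<open>The dual of V enters only as an abelian measurable group on which Q acts measurably by
  automorphisms.\<close>

locale essentially_bijective_coboundary =
  Q: measurable_group \<mu> + W: measurable_group \<nu>
  for \<mu> :: "'q::group_add measure" and \<nu> :: "'w::ab_group_add measure" +
  fixes act :: "'q \<Rightarrow> 'w \<Rightarrow> 'w" and \<xi>0 :: 'w and \<eta> :: "'q \<Rightarrow> 'w" and \<zeta> :: "'w \<Rightarrow> 'q"
  assumes act_measurable: "(\<lambda>p. act (fst p) (snd p)) \<in> \<mu> \<Otimes>\<^sub>M \<nu> \<rightarrow>\<^sub>M \<nu>"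
    and act_add: "act (p + q) x = act p (act q x)"
    and act_zero: "act 0 x = x"
    and act_plus: "act q (x + y) = act q x + act q y"
    and eta_eq: "\<eta> q = act q \<xi>0 - \<xi>0"
    and eta_iso: "measure_class_iso \<mu> \<nu> \<eta>"
    and eta_inverse: "ae_inverse \<mu> \<nu> \<eta> \<zeta>"
begin

abbreviation orb :: "'q \<Rightarrow> 'w" where "orb q \<equiv> act q \<xi>0"

text \<open>With the exceptional null set kept as a predicate, identities for \<open>\<zeta>\<close>
  can be proved pointwise and genericity checked separately.\<close>

definition good :: "'w \<Rightarrow> bool" where "good x \<longleftrightarrow> \<eta> (\<zeta> x) = x"

lemma measurable_act [measurable (raw)]:
  assumes [measurable]: "f \<in> N \<rightarrow>\<^sub>M \<mu>" "g \<in> N \<rightarrow>\<^sub>M \<nu>"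
  shows "(\<lambda>x. act (f x) (g x)) \<in> N \<rightarrow>\<^sub>M \<nu>"
  using measurable_compose[OF measurable_Pair[OF assms] act_measurable] by simp

lemma measurable_eta [measurable]: "\<eta> \<in> \<mu> \<rightarrow>\<^sub>M \<nu>"
proof -
  have "(\<lambda>q. act q \<xi>0 - \<xi>0) \<in> \<mu> \<rightarrow>\<^sub>M \<nu>" by measurable
  moreover have "\<eta> = (\<lambda>q. act q \<xi>0 - \<xi>0)" by (rule ext) (rule eta_eq)
  ultimately show ?thesis by simp
qed

lemma measurable_zeta [measurable]: "\<zeta> \<in> \<nu> \<rightarrow>\<^sub>M \<mu>"
  using eta_inverse by (simp add: ae_inverse_def)

section \<open>Algebra of the linear action and of the cocycle\<close>

lemma act_uminus: "act q (- x) = - act q x"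
  using act_plus[of q x "- x"] act_plus[of q 0 0] by (simp add: eq_neg_iff_add_eq_0 add.commute)

lemma act_minus: "act q (x - y) = act q x - act q y"
  using act_plus[of q x "- y"] by (simp add: act_uminus)

lemma act_cancel [simp]: "act (- q) (act q x) = x" "act q (act (- q) x) = x"
  by (simp_all flip: act_add add: act_zero)

lemma eta_zero: "\<eta> 0 = 0"
  by (simp add: eta_eq act_zero)

lemma eta_add: "\<eta> (p + q) = \<eta> p + act p (\<eta> q)"
  by (simp add: eta_eq act_add act_minus)

lemma eta_uminus: "\<eta> (- p) = - act (- p) (\<eta> p)"
  by (simp add: eta_eq act_minus)

lemma orb_eq_eta: "orb q = \<eta> q + \<xi>0"
  by (simp add: eta_eq)

section \<open>Null sets under the cocycle, its inverse and the action\<close>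

lemma AE_zeta_eta: "AE q in \<mu>. \<zeta> (\<eta> q) = q"
  using eta_inverse by (simp add: ae_inverse_def)

lemma AE_good: "AE x in \<nu>. good x"
  using eta_inverse by (simp add: ae_inverse_def good_def)

text \<open>The stabiliser of \<open>\<xi>0\<close> is trivial, because \<open>\<eta>\<close> is injective up to a null set.\<close>

lemma eta_inj: "\<eta> p = \<eta> q \<Longrightarrow> p = q"
proof -
  assume "\<eta> p = \<eta> q"
  then have "act (- q) (orb p) = \<xi>0" by (simp add: eta_eq)
  then have s: "orb (- q + p) = \<xi>0" by (simp add: act_add del: uminus_add_conv_diff)
  \<comment> \<open>Right translation by the stabilising element \<open>- q + p\<close> does not
    change \<open>\<eta>\<close>, so at a point where both \<open>x\<close> and its translate are
    recovered by \<open>\<zeta>\<close> the two coincide.\<close>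
  have "AE x in \<mu>. \<zeta> (\<eta> x) = x \<and> \<zeta> (\<eta> (x + (- q + p))) = x + (- q + p)"
    using AE_zeta_eta Q.AE_add_right[OF AE_zeta_eta] by eventually_elim simp
  then obtain x where x: "\<zeta> (\<eta> x) = x" "\<zeta> (\<eta> (x + (- q + p))) = x + (- q + p)"
    using Q.AE_ex by blast
  have "\<eta> (x + (- q + p)) = \<eta> x" unfolding eta_eq act_add[of x] s ..
  with x have "x + (- q + p) = x + 0" by simp
  then have "- q + p = 0" by (simp only: add_left_cancel)
  then show "p = q" by (simp only: neg_eq_iff_add_eq_0[symmetric] minus_minus)
qed

lemma orb_inj: "orb p = orb q \<Longrightarrow> p = q"
  by (rule eta_inj) (simp add: eta_eq)

text \<open>Since \<open>\<eta>\<close> is injective everywhere, goodness of \<open>x\<close> is the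
  only genericity condition.\<close>

lemma zeta_eqI: "good x \<Longrightarrow> \<eta> q = x \<Longrightarrow> \<zeta> x = q"
  by (rule eta_inj) (simp add: good_def)

text \<open>Off \<open>A\<close> the preimage of the null set \<open>N\<close> is mapped by
  \<open>\<eta>\<close> onto \<open>N - B\<close>, so it is null because \<open>\<eta>\<close>
  reflects null sets.\<close>

lemma AE_eta:
  assumes "AE x in \<nu>. P x"
  shows "AE q in \<mu>. P (\<eta> q)"
proof -
  obtain N where N: "N \<in> null_sets \<nu>" "{x \<in> space \<nu>. \<not> P x} \<subseteq> N"
    using assms by (auto simp: eventually_ae_filter)
  obtain A B where A: "A \<in> null_sets \<mu>" and B: "B \<in> null_sets \<nu>"
    and bij: "bij_betw \<eta> (space \<mu> - A) (space \<nu> - B)"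
    and iff: "\<And>S. S \<in> sets \<mu> \<Longrightarrow> S \<subseteq> space \<mu> - A \<Longrightarrow> S \<in> null_sets \<mu> \<longleftrightarrow> \<eta> ` S \<in> null_sets \<nu>"
    using eta_iso unfolding measure_class_iso_def by blast
  define S where "S = \<eta> -` N \<inter> space \<mu> - A"
  have S: "S \<in> sets \<mu>" "S \<subseteq> space \<mu> - A"
    using N(1) A measurable_sets[OF measurable_eta, of N] by (auto simp: S_def)
  have "\<eta> ` (UNIV - A) = UNIV - B"
    using bij_betw_imp_surj_on[OF bij] by (simp add: W.space_UNIV Q.space_UNIV)
  moreover have "\<eta> ` S = \<eta> ` (UNIV - A) \<inter> N"
    by (auto simp: S_def Q.space_UNIV)
  ultimately have "\<eta> ` S = N - B" by auto
  then have "S \<in> null_sets \<mu>" using iff[OF S] null_set_Diff N(1) B by auto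
  with A have "S \<union> A \<in> null_sets \<mu>" by (simp add: null_sets.Un)
  then show ?thesis
    by (rule AE_I') (use N(2) in \<open>auto simp: S_def W.space_UNIV\<close>)
qed

lemma AE_zeta:
  assumes "AE q in \<mu>. P q"
  shows "AE x in \<nu>. P (\<zeta> x)"
proof -
  obtain N where N: "N \<in> null_sets \<mu>" "{x \<in> space \<mu>. \<not> P x} \<subseteq> N"
    using assms by (auto simp: eventually_ae_filter)
  obtain A B where A: "A \<in> null_sets \<mu>" and B: "B \<in> null_sets \<nu>"
    and bij: "bij_betw \<eta> (space \<mu> - A) (space \<nu> - B)"
    and iff: "\<And>S. S \<in> sets \<mu> \<Longrightarrow> S \<subseteq> space \<mu> - A \<Longrightarrow> S \<in> null_sets \<mu> \<longleftrightarrow> \<eta> ` S \<in> null_sets \<nu>"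
    using eta_iso unfolding measure_class_iso_def by blast
  have "N - A \<in> null_sets \<mu>" using N(1) A by (auto intro: null_set_Diff)
  then have *: "\<eta> ` (N - A) \<in> null_sets \<nu>"
    using iff[of "N - A"] by (auto simp: Q.space_UNIV)
  show ?thesis
    using AE_good AE_not_in[OF *] AE_not_in[OF B]
  proof eventually_elim
    case (elim x)
    have "\<eta> ` (UNIV - A) = UNIV - B"
      using bij_betw_imp_surj_on[OF bij] by (simp add: W.space_UNIV Q.space_UNIV)
    then have "x \<in> \<eta> ` (UNIV - A)" using elim by simp
    then obtain q where q: "q \<notin> A" "\<eta> q = x" by auto
    then have "\<zeta> x = q" using elim(1) by (intro zeta_eqI)
    with elim q have "\<zeta> x \<notin> A" "\<zeta> x \<notin> N - A" by auto
    then show ?case using N(2) by (auto simp: Q.space_UNIV)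
  qed
qed

lemma AE_orb: "AE x in \<nu>. P x \<Longrightarrow> AE q in \<mu>. P (orb q)"
  unfolding orb_eq_eta by (intro AE_eta W.AE_add_right)

lemma AE_good_orb: "AE q in \<mu>. good (orb q)"
  by (rule AE_orb[OF AE_good])

text \<open>In the coordinates given by \<open>\<eta>\<close> the linear action is left translation
  on Q followed by a translation on the dual, as
  \<open>act q (\<eta> p) = \<eta> (q + p) - \<eta> q\<close>; both preserve null sets.\<close>

lemma AE_act:
  assumes "AE x in \<nu>. P x"
  shows "AE x in \<nu>. P (act q x)"
proof -
  have "AE p in \<mu>. P (\<eta> p + - \<eta> q)" by (rule AE_eta[OF W.AE_add_right[OF assms]])
  then have "AE p in \<mu>. P (\<eta> (q + p) + - \<eta> q)" by (rule Q.AE_add_left)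
  then have "AE x in \<nu>. P (act q (\<eta> (\<zeta> x)))" by (intro AE_zeta) (simp add: eta_add)
  with AE_good show ?thesis by eventually_elim (simp add: good_def)
qed

text \<open>The translation by \<open>\<xi>0\<close> and its inverse, in the coordinates on \<open>\<nu>\<close> given by \<open>\<eta>\<close>.\<close>

definition up :: "'q \<Rightarrow> 'q" where "up q = \<zeta> (orb q)"
definition down :: "'q \<Rightarrow> 'q" where "down q = \<zeta> (\<eta> q - \<xi>0)"

lemma measurable_up [measurable]: "up \<in> \<mu> \<rightarrow>\<^sub>M \<mu>"
  unfolding up_def by measurable

lemma measurable_down [measurable]: "down \<in> \<mu> \<rightarrow>\<^sub>M \<mu>"
  unfolding down_def by measurable

lemma AE_up: "AE q in \<mu>. P q \<Longrightarrow> AE q in \<mu>. P (up q)"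
  unfolding up_def by (intro AE_orb AE_zeta)

lemma AE_down: "AE q in \<mu>. P q \<Longrightarrow> AE q in \<mu>. P (down q)"
  unfolding down_def diff_conv_add_uminus by (intro AE_eta W.AE_add_right AE_zeta)

lemma eta_up: "good (orb q) \<Longrightarrow> \<eta> (up q) = orb q"
  by (simp add: up_def good_def)

lemma orb_down: "good (\<eta> q - \<xi>0) \<Longrightarrow> orb (down q) = \<eta> q"
  by (simp add: down_def good_def orb_eq_eta)

lemma AE_down_up: "AE q in \<mu>. down (up q) = q"
  using AE_good_orb AE_zeta_eta
proof eventually_elim
  case (elim q)
  then have "\<eta> (up q) = \<eta> q + \<xi>0" by (simp add: eta_up orb_eq_eta)
  with elim show ?case by (simp add: down_def)
qed

text \<open>The cocycle identity applied to \<open>- up p + up q\<close>. It gives the orbit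
  coordinate of the last component of \<open>pent_v\<close>.\<close>

lemma orb_down_diff:
  assumes "good (orb p)" "good (orb q)" "good (\<eta> (- up p + up q) - \<xi>0)"
  shows "orb (down (- up p + up q)) = act (- up p) (orb q - orb p)"
  using orb_down[OF assms(3)] eta_up[OF assms(1)] eta_up[OF assms(2)]
  by (simp add: eta_add eta_uminus act_minus del: uminus_add_conv_diff)

end

section \<open>Separation of variables in the coboundary relation\<close>

lemma measurable_pred_eq_complex:
  fixes f g :: "'a \<Rightarrow> complex"
  assumes "f \<in> borel_measurable M" "g \<in> borel_measurable M"
  shows "Measurable.pred M (\<lambda>x. f x = g x)"
  unfolding pred_def by (rule measurable_equality_set[OF assms])

context essentially_bijective_coboundary
begin

text \<open>
  Since \<open>R\<close> does not depend on the first variable, the two instances of the relation for a generic \<open>q\<close> and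
  a fixed generic one can be divided by each other. In the coordinates \<open>(a, - q + a)\<close> for \<open>(q, orb a)\<close>,
  this separates the variables.
\<close>

lemma separate_variables:
  fixes f :: "'q \<times> 'w \<Rightarrow> complex"
  assumes f [measurable]: "f \<in> borel_measurable (\<mu> \<Otimes>\<^sub>M \<nu>)" and norm: "\<And>p. cmod (f p) = 1"
    and rel: "AE q in \<mu>. AE x in \<nu>. AE p in \<mu>. AE y in \<nu>. f (q, x) = R x p y * f (p + q, act p x)"
  obtains k m where "k \<in> borel_measurable \<mu>" "m \<in> borel_measurable \<mu>"
    "\<And>a. cmod (k a) = 1" "\<And>a. cmod (m a) = 1"
    "AE a in \<mu>. AE q in \<mu>. f (q, orb a) = k a * m (- q + a)"
proof -
  obtain q' where q': "AE x in \<nu>. AE p in \<mu>. AE y in \<nu>. f (q', x) = R x p y * f (p + q', act p x)"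
    using Q.AE_ex[OF rel] by blast
  have "AE q in \<mu>. AE x in \<nu>. AE p in \<mu>. f (q, x) * f (p + q', act p x) = f (q', x) * f (p + q, act p x)"
    using rel
  proof eventually_elim
    case (elim q)
    show ?case
      using elim q'
    proof eventually_elim
      case (elim x)
      then show ?case
      proof eventually_elim
        case (elim p)
        then have "AE y in \<nu>. f (q, x) = R x p y * f (p + q, act p x) \<and> f (q', x) = R x p y * f (p + q', act p x)"
          by eventually_elim simp
        then obtain y where "f (q, x) = R x p y * f (p + q, act p x)" "f (q', x) = R x p y * f (p + q', act p x)"
          using W.AE_ex by blast
        then show ?case by (simp only: mult_ac)
      qed
    qed
  qed
  then have "AE q in \<mu>. AE a in \<mu>. AE p in \<mu>. f (q, orb a) * f (p + q', act p (orb a)) = f (q', orb a) * f (p + q, act p (orb a))"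
    by eventually_elim (rule AE_orb)
  \<comment> \<open>Substitution \<open>g = p + a\<close>, so that
    \<open>act p (orb a) = orb g\<close>.\<close>
  then have "AE q in \<mu>. AE a in \<mu>. AE g in \<mu>.
      f (q, orb a) * f (g + - a + q', orb g) = f (q', orb a) * f (g + - a + q, orb g)"
  proof eventually_elim
    case (elim q)
    then show ?case
    proof eventually_elim
      case (elim a)
      from Q.AE_add_right[OF this, of "- a"] show ?case by (simp add: act_add del: add_uminus_conv_diff)
    qed
  qed
  then have "AE g in \<mu>. AE a in \<mu>. AE q in \<mu>.
      f (q, orb a) * f (g + - a + q', orb g) = f (q', orb a) * f (g + - a + q, orb g)"
    by (rule Q.AE_rotate3[rotated]) (rule measurable_pred_eq_complex; measurable)
  then obtain g where g: "AE a in \<mu>. AE q in \<mu>.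
      f (q, orb a) * f (g + - a + q', orb g) = f (q', orb a) * f (g + - a + q, orb g)"
    using Q.AE_ex by blast
  \<comment> \<open>Solve the relation at the fixed \<open>g\<close> for
    \<open>f (q, orb a)\<close>: the remaining factor \<open>f (g + - a + q, orb g)\<close> depends
    on \<open>- q + a\<close> only.\<close>
  define k where "k a = f (q', orb a) / f (g + - a + q', orb g)" for a
  define m where "m h = f (g + - h, orb g)" for h
  show thesis
  proof
    show "k \<in> borel_measurable \<mu>" unfolding k_def by measurable
    show "m \<in> borel_measurable \<mu>" unfolding m_def by measurable
    show "cmod (k a) = 1" "cmod (m a) = 1" for a
      by (simp_all add: k_def m_def norm norm_divide)
    show "AE a in \<mu>. AE q in \<mu>. f (q, orb a) = k a * m (- q + a)"
      using g
    proof eventually_elim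
      case (elim a)
      have nz: "f p \<noteq> 0" for p using norm[of p] by auto
      from elim show ?case
        by eventually_elim
          (simp add: k_def m_def nz field_simps minus_add add.assoc del: add_uminus_conv_diff uminus_add_conv_diff)
    qed
  qed
qed

text \<open>
  With \<open>f (q, orb a) = k a * m (- q + a)\<close>, the relation \<open>\<theta>_c = (f \<otimes> f) / ((f \<otimes> f) \<circ> v)\<close> separates into terms
  depending on \<open>(a, b)\<close>, collected in \<open>cob_U\<close>, and terms depending on \<open>(g + a, g + b)\<close>, collected in \<open>cob_V\<close>.
\<close>

definition cob_U :: "('q \<times> 'q \<Rightarrow> complex) \<Rightarrow> ('q \<Rightarrow> complex) \<Rightarrow> ('q \<Rightarrow> complex) \<Rightarrow> 'q \<Rightarrow> 'q \<Rightarrow> complex" where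
  "cob_U c k m a b = k a * m b * c (- up b + up a, - up a) / m (down (- up a + up b))"

definition cob_V :: "('q \<times> 'q \<Rightarrow> complex) \<Rightarrow> ('q \<Rightarrow> complex) \<Rightarrow> 'q \<Rightarrow> 'q \<Rightarrow> complex" where
  "cob_V c k a b = k a * k (down (- up a + up b)) * c (- up b + up a, - up a) / k b"

text \<open>After inserting the separated form into the four factors, \<open>f (q, x)\<close> and
  \<open>f (p + q, act p x)\<close> contribute the same value of \<open>m\<close>, so
  \<open>q\<close> cancels. Sorting the rest by \<open>(a, b)\<close> and
  \<open>(g + a, g + b)\<close> gives the two sides.\<close>

lemma cob_relation:
  fixes f :: "'q \<times> 'w \<Rightarrow> complex"
  assumes f [measurable]: "f \<in> borel_measurable (\<mu> \<Otimes>\<^sub>M \<nu>)"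
    and k [measurable]: "k \<in> borel_measurable \<mu>" and m [measurable]: "m \<in> borel_measurable \<mu>"
    and nk: "\<And>a. cmod (k a) = 1" and nm: "\<And>a. cmod (m a) = 1" and nc: "\<And>p. cmod (c p) = 1"
    and sep: "AE a in \<mu>. AE q in \<mu>. f (q, orb a) = k a * m (- q + a)"
    and rel: "AE q in \<mu>. AE x in \<nu>. AE p in \<mu>. AE y in \<nu>.
      cnj (c (- \<zeta> (act (- p) y) + \<zeta> x, - \<zeta> x)) * c (- \<zeta> y + \<zeta> (act p x), - \<zeta> (act p x)) =
      f (q, x) * f (p, y) / (f (p + q, act p x) *
        f (- \<zeta> (\<eta> (- p) + x) + \<zeta> x, act (- \<zeta> (\<eta> (- p) + x)) (act (- p) y - x)))"
  shows "AE a in \<mu>. AE g in \<mu>. AE b in \<mu>. cob_V c k (g + a) (g + b) = cob_U c k m a b"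
proof -
  interpret P: pair_sigma_finite \<mu> \<mu> by (rule Q.pair_sigma_finite_self)
  let ?s = "\<lambda>q a. f (q, orb a) = k a * m (- q + a)"
  have sep': "AE q in \<mu>. AE a in \<mu>. ?s q a"
    using sep by (subst (asm) P.AE_commute) (rule measurable_pred_eq_complex[unfolded pred_def]; measurable)
  have s1: "AE q in \<mu>. AE a in \<mu>. AE g in \<mu>. ?s (g + q) (g + a)"
  proof -
    have "AE q in \<mu>. AE a in \<mu>. ?s q (q + a)"
      using sep' by eventually_elim (rule Q.AE_add_left)
    then have "AE a in \<mu>. AE q in \<mu>. ?s q (q + a)"
      by (subst (asm) P.AE_commute) (rule measurable_pred_eq_complex[unfolded pred_def]; measurable)
    then have "AE a in \<mu>. AE g in \<mu>. ?s (g + q) (g + q + a)" for q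
      by eventually_elim (rule Q.AE_add_right)
    then have "AE a in \<mu>. AE g in \<mu>. ?s (g + q) (g + q + (- q + a))" for q
      by (rule Q.AE_add_left)
    then show ?thesis by (simp add: add.assoc del: add_uminus_conv_diff uminus_add_conv_diff)
  qed
  have s2: "AE g in \<mu>. AE b in \<mu>. ?s g (g + b)"
    using sep' by eventually_elim (rule Q.AE_add_left)
  \<comment> \<open>For almost every \<open>g\<close> the first coordinate of the last factor is
    generic, and its second coordinate depends on \<open>b\<close> through a chain of nonsingular
    maps.\<close>
  have s3: "AE g in \<mu>. AE b in \<mu>.
      ?s (- \<zeta> (\<eta> (- g) + orb a) + up a) (down (- up (g + a) + up (g + b)))" for a
  proof -
    have "AE g in \<mu>. AE y in \<mu>. ?s (- \<zeta> (\<eta> (- g) + orb a) + up a) y"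
      by (rule Q.AE_minus, rule AE_eta, rule W.AE_add_right, rule AE_zeta, rule Q.AE_minus,
          rule Q.AE_add_right, rule sep')
    then show ?thesis
    proof eventually_elim
      case (elim g)
      show ?case
        by (rule Q.AE_add_left, rule AE_up, rule Q.AE_add_left, rule AE_down, rule elim)
    qed
  qed
  have g1: "AE b in \<mu>. good (\<eta> (- up p + up (g + b)) - \<xi>0)" for p g
    by (rule Q.AE_add_left, rule AE_up, rule Q.AE_add_left, rule AE_eta,
        simp only: diff_conv_add_uminus, rule W.AE_add_right, rule AE_good)
  have g2: "AE b in \<mu>. good (orb (g + b))" for g
    by (rule Q.AE_add_left[OF AE_good_orb])
  have g3: "AE g in \<mu>. good (\<eta> (- g) + x)" for x
    by (rule Q.AE_minus, rule AE_eta, rule W.AE_add_right, rule AE_good)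
  have g4: "AE g in \<mu>. good (orb (g + a))" for a
    by (rule Q.AE_add_right[OF AE_good_orb])
  \<comment> \<open>Change of variables \<open>x = orb a\<close>, \<open>p = g\<close>,
    \<open>y = orb (g + b)\<close>, for which \<open>act (- g) y = orb b\<close>.\<close>
  have rel': "AE q in \<mu>. AE a in \<mu>. AE g in \<mu>. AE b in \<mu>.
      cnj (c (- up b + up a, - up a)) * c (- up (g + b) + up (g + a), - up (g + a)) =
      f (q, orb a) * f (g, orb (g + b)) / (f (g + q, orb (g + a)) *
        f (- \<zeta> (\<eta> (- g) + orb a) + up a, act (- \<zeta> (\<eta> (- g) + orb a)) (orb b - orb a)))"
    using rel
  proof eventually_elim
    case (elim q)
    from AE_orb[OF elim] show ?case
    proof eventually_elim
      case (elim a)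
      then show ?case
      proof eventually_elim
        case (elim g)
        from Q.AE_add_left[OF AE_orb[OF elim], of g] show ?case
          by (simp add: up_def act_add del: add_uminus_conv_diff uminus_add_conv_diff)
      qed
    qed
  qed
  have "AE q in \<mu>. AE a in \<mu>. AE g in \<mu>. AE b in \<mu>. cob_V c k (g + a) (g + b) = cob_U c k m a b"
    using rel' sep' s1
  proof eventually_elim
    case (elim q)
    then show ?case
      using AE_good_orb
    proof eventually_elim
      case (elim a)
      note qa = elim
      from elim(1,3) s2 s3[of a] g3[of "orb a"] g4[of a] show ?case
      proof eventually_elim
        case (elim g)
        note ga = elim
        from elim(1,3,4) g1[of "g + a" g] g1[of a 0] g2[of g] g2[of 0] show ?case
        proof eventually_elim
          case (elim b)
          \<comment> \<open>This is the element with \<open>up (g + a) = g + r\<close>: both sides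
            have the same image under the injective map \<open>\<eta>\<close>.\<close>
          define r where "r = \<zeta> (\<eta> (- g) + orb a)"
          have "\<eta> (g + r) = \<eta> (up (g + a))"
          proof -
            have "\<eta> (g + r) = \<eta> g + act g (\<eta> (- g)) + orb (g + a)"
              using ga(5) by (simp add: eta_add r_def good_def act_plus act_add)
            moreover have "\<eta> g + act g (\<eta> (- g)) = 0"
              using eta_add[of g "- g"] eta_zero by simp
            ultimately show ?thesis using eta_up[OF ga(6)] by simp
          qed
          then have gr: "up (g + a) = g + r" using eta_inj by metis
          have y: "orb (down (- up (g + a) + up (g + b))) = act (- r) (orb b - orb a)"
            using orb_down_diff[OF ga(6), of "g + b"] elim
            by (simp add: gr minus_add act_add act_minus del: add_uminus_conv_diff uminus_add_conv_diff)
          \<comment> \<open>The action by \<open>r\<close> cancels, so the argument of the last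
            \<open>m\<close> does not depend on \<open>g\<close>; this is why it belongs to
            \<open>cob_U\<close>.\<close>
          have "orb (- (- r + up a) + down (- up (g + a) + up (g + b))) = orb (down (- up a + up b))"
            using orb_down_diff[OF qa(4), of b] elim
            by (simp add: act_add y minus_add del: add_uminus_conv_diff uminus_add_conv_diff)
          then have z: "- (- r + up a) + down (- up (g + a) + up (g + b)) = down (- up a + up b)"
            by (rule orb_inj)
          have c1: "- g + (g + b) = b" "- (g + q) + (g + a) = - q + a"
            by (simp_all add: minus_add add.assoc del: add_uminus_conv_diff uminus_add_conv_diff)
          have nz: "k x \<noteq> 0" "m x \<noteq> 0" "c p \<noteq> 0" for x p
            using nk[of x] nm[of x] nc[of p] by auto
          have cc: "cnj (c p) = 1 / c p" for p
            using nc[of p] nz(3)[of p] by (simp add: divide_conv_cnj)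
          have "cnj (c (- up b + up a, - up a)) * c (- up (g + b) + up (g + a), - up (g + a)) =
              (k a * m (- q + a)) * (k (g + b) * m b) / ((k (g + a) * m (- q + a)) *
              (k (down (- up (g + a) + up (g + b))) * m (down (- up a + up b))))"
            using elim(1-3) qa(2) ga(2) unfolding r_def[symmetric] y[symmetric] z c1 by simp
          then show ?case
            unfolding cob_U_def cob_V_def cc by (simp add: nz field_simps)
        qed
      qed
    qed
  qed
  then show ?thesis using Q.AE_ex by blast
qed

text \<open>Fix a generic \<open>a'\<close>. Then \<open>cob_V\<close> at
  \<open>(g + a', g + b)\<close> is independent of \<open>g\<close>, so it depends only on the
  difference of its arguments. Taking \<open>\<rho>\<close> from \<open>cob_U\<close> makes
  measurability and modulus 1 immediate.\<close>

lemma cob_V_invariant: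
  assumes c [measurable]: "c \<in> borel_measurable (\<mu> \<Otimes>\<^sub>M \<mu>)"
    and k [measurable]: "k \<in> borel_measurable \<mu>" and m [measurable]: "m \<in> borel_measurable \<mu>"
    and nk: "\<And>a. cmod (k a) = 1" and nm: "\<And>a. cmod (m a) = 1" and nc: "\<And>p. cmod (c p) = 1"
    and rel: "AE a in \<mu>. AE g in \<mu>. AE b in \<mu>. cob_V c k (g + a) (g + b) = cob_U c k m a b"
  obtains \<rho> where "\<rho> \<in> borel_measurable \<mu>" "\<And>d. cmod (\<rho> d) = 1"
    "AE a in \<mu>. AE b in \<mu>. cob_V c k a b = \<rho> (- a + b)"
proof -
  obtain a' where a': "AE g in \<mu>. AE b in \<mu>. cob_V c k (g + a') (g + b) = cob_U c k m a' b"
    using Q.AE_ex[OF rel] by blast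
  define \<rho> where "\<rho> d = cob_U c k m a' (a' + d)" for d
  show thesis
  proof
    show "\<rho> \<in> borel_measurable \<mu>" unfolding \<rho>_def cob_U_def by measurable
    show "cmod (\<rho> d) = 1" for d
      by (simp add: \<rho>_def cob_U_def norm_mult norm_divide nk nm nc)
    from Q.AE_add_right[OF a', of "- a'"]
    show "AE a in \<mu>. AE b in \<mu>. cob_V c k a b = \<rho> (- a + b)"
    proof eventually_elim
      case (elim a)
      from Q.AE_add_left[OF elim, of "a' + - a"] show ?case
        by eventually_elim
          (simp add: \<rho>_def add.assoc del: add_uminus_conv_diff uminus_add_conv_diff)
    qed
  qed
qed

section \<open>Translation invariance and primitives on Q\<close>

lemma AE3_subst:
  assumes "AE z in \<nu>. AE y in \<nu>. AE x in \<nu>. P x y z"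
    and "\<And>P. AE x in \<nu>. P x \<Longrightarrow> AE x in \<nu>. P (T x)"
  shows "AE z in \<nu>. AE y in \<nu>. AE x in \<nu>. P (T x) (T y) (T z)"
  using assms(2)[OF assms(1)]
proof eventually_elim
  case (elim z)
  from assms(2)[OF elim] show ?case
    by eventually_elim (rule assms(2))
qed

lemma AE3_combine:
  assumes "AE z in \<nu>. AE y in \<nu>. AE x in \<nu>. P x y z" "AE z in \<nu>. AE y in \<nu>. AE x in \<nu>. P' x y z"
    and "\<And>x y z. P x y z \<Longrightarrow> P' x y z \<Longrightarrow> P'' x y z"
  shows "AE z in \<nu>. AE y in \<nu>. AE x in \<nu>. P'' x y z"
  using assms(1,2)
proof eventually_elim
  case (elim z)
  then show ?case
  proof eventually_elim
    case (elim y)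
    then show ?case by eventually_elim (rule assms(3))
  qed
qed

lemma AE3_I:
  assumes "AE x in \<nu>. P x" "\<And>x y z. P x \<Longrightarrow> P y \<Longrightarrow> P z \<Longrightarrow> R x y z"
  shows "AE z in \<nu>. AE y in \<nu>. AE x in \<nu>. R x y z"
  using assms(1)
proof eventually_elim
  case z: (elim z)
  from assms(1) show ?case
  proof eventually_elim
    case y: (elim y)
    from assms(1) show ?case
      by eventually_elim (rule assms(2)[OF _ y z])
  qed
qed

text \<open>The cocycle identity says that \<open>\<eta>\<close> intertwines left translation on Q
  with the affine action; this is the same fact for \<open>\<zeta>\<close>.\<close>

lemma zeta_affine:
  assumes "good x" "good (\<eta> g + act g x)"
  shows "\<zeta> (\<eta> g + act g x) = g + \<zeta> x"
  by (rule zeta_eqI) (use assms in \<open>auto simp: eta_add good_def\<close>)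

lemma AE3_zeta_invariant:
  assumes "\<And>a b d. F (g + a) (g + b) (g + d) = (F a b d :: complex)"
  shows "AE z in \<nu>. AE y in \<nu>. AE x in \<nu>.
    F (\<zeta> (\<eta> g + act g x)) (\<zeta> (\<eta> g + act g y)) (\<zeta> (\<eta> g + act g z)) = F (\<zeta> x) (\<zeta> y) (\<zeta> z)"
proof (rule AE3_I)
  show "AE x in \<nu>. \<zeta> (\<eta> g + act g x) = g + \<zeta> x"
    using AE_good AE_act[OF W.AE_add_left[OF AE_good]]
    by eventually_elim (rule zeta_affine)
qed (simp add: assms)

text \<open>
  Being invariant under the linear action and under its conjugate by the translation by \<open>\<xi>0\<close>, a
  homogeneous cochain is invariant under the translations by \<open>\<eta> g\<close>, hence under all translations,
  because almost every element is of the form \<open>\<eta> g\<close>.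
\<close>

lemma translation_invariant:
  fixes h \<gamma> :: "'q \<Rightarrow> 'q \<Rightarrow> 'q \<Rightarrow> complex"
  assumes h: "\<And>g a b d. h (g + a) (g + b) (g + d) = h a b d"
    and \<gamma>: "\<And>g a b d. \<gamma> (g + a) (g + b) (g + d) = \<gamma> a b d"
    and eq: "AE d in \<mu>. AE b in \<mu>. AE a in \<mu>. h (up a) (up b) (up d) = \<gamma> a b d"
  shows "AE d in \<mu>. AE b in \<mu>. AE a in \<mu>. h a b d = \<gamma> a b d"
proof -
  define H where "H x y z = h (\<zeta> x) (\<zeta> y) (\<zeta> z)" for x y z
  define G where "G x y z = \<gamma> (\<zeta> x) (\<zeta> y) (\<zeta> z)" for x y z
  \<comment> \<open>In the coordinates given by \<open>\<zeta>\<close>, the map \<open>up\<close> is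
    translation by \<open>\<xi>0\<close>.\<close>
  have HG: "AE z in \<nu>. AE y in \<nu>. AE x in \<nu>. H (x + \<xi>0) (y + \<xi>0) (z + \<xi>0) = G x y z"
  proof (rule AE3_combine)
    from AE_zeta[OF eq]
    show "AE z in \<nu>. AE y in \<nu>. AE x in \<nu>. h (up (\<zeta> x)) (up (\<zeta> y)) (up (\<zeta> z)) = \<gamma> (\<zeta> x) (\<zeta> y) (\<zeta> z)"
    proof eventually_elim
      case (elim z)
      from AE_zeta[OF elim] show ?case
        by eventually_elim (rule AE_zeta)
    qed
    show "AE z in \<nu>. AE y in \<nu>. AE x in \<nu>.
        up (\<zeta> x) = \<zeta> (x + \<xi>0) \<and> up (\<zeta> y) = \<zeta> (y + \<xi>0) \<and> up (\<zeta> z) = \<zeta> (z + \<xi>0)"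
      by (rule AE3_I[OF AE_good]) (simp add: up_def orb_eq_eta good_def)
  qed (simp add: H_def G_def)
  have aff: "AE z in \<nu>. AE y in \<nu>. AE x in \<nu>. H (\<eta> g + act g x) (\<eta> g + act g y) (\<eta> g + act g z) = H x y z"
    "AE z in \<nu>. AE y in \<nu>. AE x in \<nu>. G (\<eta> g + act g x) (\<eta> g + act g y) (\<eta> g + act g z) = G x y z" for g
    unfolding H_def G_def by (rule AE3_zeta_invariant; rule h \<gamma>)+
  have lin: "AE z in \<nu>. AE y in \<nu>. AE x in \<nu>. H (act g x) (act g y) (act g z) = H x y z" for g
  proof -
    \<comment> \<open>Translation by \<open>\<xi>0\<close> conjugates the affine action into the
      linear one.\<close>
    have t: "\<eta> g + act g x + \<xi>0 = act g (x + \<xi>0)" for x by (simp add: eta_eq act_plus)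
    have "AE z in \<nu>. AE y in \<nu>. AE x in \<nu>.
        H (act g (x + \<xi>0)) (act g (y + \<xi>0)) (act g (z + \<xi>0)) = G (\<eta> g + act g x) (\<eta> g + act g y) (\<eta> g + act g z)"
      unfolding t[symmetric] by (rule AE3_subst[OF HG]) (rule AE_act[OF W.AE_add_left])
    then have "AE z in \<nu>. AE y in \<nu>. AE x in \<nu>.
        H (act g (x + \<xi>0)) (act g (y + \<xi>0)) (act g (z + \<xi>0)) = G x y z"
      by (rule AE3_combine[OF _ aff(2)[of g]]) simp
    then have "AE z in \<nu>. AE y in \<nu>. AE x in \<nu>.
        H (act g (x + \<xi>0)) (act g (y + \<xi>0)) (act g (z + \<xi>0)) = H (x + \<xi>0) (y + \<xi>0) (z + \<xi>0)"
      by (rule AE3_combine[OF _ HG]) simp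
    then have "AE z in \<nu>. AE y in \<nu>. AE x in \<nu>.
        H (act g (x + - \<xi>0 + \<xi>0)) (act g (y + - \<xi>0 + \<xi>0)) (act g (z + - \<xi>0 + \<xi>0)) =
        H (x + - \<xi>0 + \<xi>0) (y + - \<xi>0 + \<xi>0) (z + - \<xi>0 + \<xi>0)"
      by (rule AE3_subst) (rule W.AE_add_right)
    then show ?thesis by simp
  qed
  \<comment> \<open>The affine action of \<open>g\<close> composed with the linear action of
    \<open>- g\<close> is translation by \<open>\<eta> g\<close>.\<close>
  have trans: "AE z in \<nu>. AE y in \<nu>. AE x in \<nu>. H (\<eta> g + x) (\<eta> g + y) (\<eta> g + z) = H x y z" for g
  proof -
    have "AE z in \<nu>. AE y in \<nu>. AE x in \<nu>.
        H (\<eta> g + act g x) (\<eta> g + act g y) (\<eta> g + act g z) = H (act g x) (act g y) (act g z)"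
      by (rule AE3_combine[OF aff(1)[of g] lin[of g]]) simp
    then have "AE z in \<nu>. AE y in \<nu>. AE x in \<nu>.
        H (\<eta> g + act g (act (- g) x)) (\<eta> g + act g (act (- g) y)) (\<eta> g + act g (act (- g) z)) =
        H (act g (act (- g) x)) (act g (act (- g) y)) (act g (act (- g) z))"
      by (rule AE3_subst) (rule AE_act)
    then show ?thesis by simp
  qed
  \<comment> \<open>The element \<open>\<xi>0\<close> may itself lie outside the image of
    \<open>\<eta>\<close>, but it is always a sum of two values.\<close>
  have "AE x in \<nu>. good x \<and> good (\<xi>0 + - x)"
    using AE_good W.AE_minus[OF W.AE_add_left[OF AE_good]] by eventually_elim simp
  then obtain x where "good x" "good (\<xi>0 + - x)" using W.AE_ex by blast
  then obtain p q where pq: "\<xi>0 = \<eta> p + \<eta> q"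
    unfolding good_def by (metis add.commute diff_add_cancel uminus_add_conv_diff)
  have "AE z in \<nu>. AE y in \<nu>. AE x in \<nu>. H (x + \<xi>0) (y + \<xi>0) (z + \<xi>0) = H x y z"
  proof (rule AE3_combine[OF trans[of q]])
    show "AE z in \<nu>. AE y in \<nu>. AE x in \<nu>.
        H (\<eta> p + (\<eta> q + x)) (\<eta> p + (\<eta> q + y)) (\<eta> p + (\<eta> q + z)) = H (\<eta> q + x) (\<eta> q + y) (\<eta> q + z)"
      by (rule AE3_subst[OF trans[of p]]) (rule W.AE_add_left)
  qed (simp add: pq add_ac)
  then have fin: "AE z in \<nu>. AE y in \<nu>. AE x in \<nu>. H x y z = G x y z"
    by (rule AE3_combine[OF _ HG]) simp
  show ?thesis
    using AE_eta[OF fin] AE_zeta_eta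
  proof eventually_elim
    case d: (elim d)
    from AE_eta[OF d(1)] AE_zeta_eta show ?case
    proof eventually_elim
      case b: (elim b)
      from AE_eta[OF b(1)] AE_zeta_eta show ?case
        by eventually_elim (simp add: H_def G_def b d)
    qed
  qed
qed

text \<open>The hypothesis makes the homogeneous cocycle of \<open>c\<close>, composed with
  \<open>up\<close>, the coboundary of a left invariant cochain. Translation invariance removes
  \<open>up\<close>, and a generic last argument brings back inhomogeneous coordinates.\<close>

lemma AE_coboundary:
  fixes c :: "'q \<times> 'q \<Rightarrow> complex" and \<rho> :: "'q \<Rightarrow> complex"
  assumes coc: "\<And>x y z. c (x, y) * c (x + y, z) = c (y, z) * c (x, y + z)"
    and nr: "\<And>x. cmod (\<rho> x) = 1"
    and eq: "AE a in \<mu>. AE b in \<mu>. c (- up b + up a, - up a) = \<rho> (- a + b)"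
  shows "AE y in \<mu>. AE x in \<mu>. c (x, y) = \<rho> (- x) * \<rho> (- y) / \<rho> (- (x + y))"
proof -
  have nz: "\<rho> x \<noteq> 0" for x using nr[of x] by auto
  define h where "h a b d = c (- a + b, - b + d)" for a b d
  define \<gamma> where "\<gamma> a b d = \<rho> (- d + b) * \<rho> (- b + a) / \<rho> (- d + a)" for a b d
  note grp = minus_add add.assoc
  have "AE d in \<mu>. AE b in \<mu>. AE a in \<mu>. h a b d = \<gamma> a b d"
  proof (rule translation_invariant)
    show "h (g + a) (g + b) (g + d) = h a b d" "\<gamma> (g + a) (g + b) (g + d) = \<gamma> a b d" for g a b d
      by (simp_all add: h_def \<gamma>_def grp del: add_uminus_conv_diff uminus_add_conv_diff)
    show "AE d in \<mu>. AE b in \<mu>. AE a in \<mu>. h (up a) (up b) (up d) = \<gamma> a b d"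
      using eq
    proof eventually_elim
      case d: (elim d)
      from eq d show ?case
      proof eventually_elim
        case b: (elim b)
        from b(1) d show ?case
        proof eventually_elim
          case (elim a)
          have "h (up a) (up b) (up d) * \<rho> (- d + a) = \<rho> (- d + b) * \<rho> (- b + a)"
            \<comment> \<open>Each of the other three factors of this instance has the form treated
              by the hypothesis.\<close>
            using coc[of "- up a + up b" "- up b + up d" "- up d"] elim b(2)
            by (simp add: h_def grp del: add_uminus_conv_diff uminus_add_conv_diff)
          then show ?case by (simp add: \<gamma>_def nz field_simps)
        qed
      qed
    qed
  qed
  then obtain d where "AE b in \<mu>. AE a in \<mu>. h a b d = \<gamma> a b d" using Q.AE_ex by blast
  \<comment> \<open>Coordinates \<open>b = d + - y\<close> and \<open>a = d + - y + - x\<close>, so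
    that \<open>- a + b = x\<close> and \<open>- b + d = y\<close>.\<close>
  from Q.AE_minus[OF Q.AE_add_left[OF this, of d]] show ?thesis
  proof eventually_elim
    case (elim y)
    from Q.AE_minus[OF Q.AE_add_left[OF elim, of "d + - y"]] show ?case
      by eventually_elim (simp add: h_def \<gamma>_def grp mult.commute del: add_uminus_conv_diff uminus_add_conv_diff)
  qed
qed

proposition pent_coboundary_imp_coboundary:
  fixes f :: "'q \<times> 'w \<Rightarrow> complex" and c :: "'q \<times> 'q \<Rightarrow> complex"
  assumes f [measurable]: "f \<in> borel_measurable (\<mu> \<Otimes>\<^sub>M \<nu>)" and nf: "\<And>p. cmod (f p) = 1"
    and c [measurable]: "c \<in> borel_measurable (\<mu> \<Otimes>\<^sub>M \<mu>)" and nc: "\<And>p. cmod (c p) = 1"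
    and coc: "\<And>x y z. c (x, y) * c (x + y, z) = c (y, z) * c (x, y + z)"
    and rel: "AE q in \<mu>. AE x in \<nu>. AE p in \<mu>. AE y in \<nu>.
      cnj (c (- \<zeta> (act (- p) y) + \<zeta> x, - \<zeta> x)) * c (- \<zeta> y + \<zeta> (act p x), - \<zeta> (act p x)) =
      f (q, x) * f (p, y) / (f (p + q, act p x) *
        f (- \<zeta> (\<eta> (- p) + x) + \<zeta> x, act (- \<zeta> (\<eta> (- p) + x)) (act (- p) y - x)))"
  shows "\<exists>b \<in> borel_measurable \<mu>. (\<forall>q. cmod (b q) = 1) \<and> (\<forall>x y. c (x, y) = b x * b y / b (x + y))"
proof -
  have nzf: "f p \<noteq> 0" for p using nf[of p] by auto
  \<comment> \<open>All factors that do not contain \<open>q\<close> are collected here.\<close>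
  define R where "R x p y =
      cnj (c (- \<zeta> (act (- p) y) + \<zeta> x, - \<zeta> x)) * c (- \<zeta> y + \<zeta> (act p x), - \<zeta> (act p x)) / f (p, y) *
      f (- \<zeta> (\<eta> (- p) + x) + \<zeta> x, act (- \<zeta> (\<eta> (- p) + x)) (act (- p) y - x))" for x p y
  have "AE q in \<mu>. AE x in \<nu>. AE p in \<mu>. AE y in \<nu>. f (q, x) = R x p y * f (p + q, act p x)"
    using rel
  proof eventually_elim
    case (elim q)
    then show ?case
    proof eventually_elim
      case (elim x)
      then show ?case
      proof eventually_elim
        case (elim p)
        then show ?case
          by eventually_elim (simp add: R_def nzf)
      qed
    qed
  qed
  from separate_variables[OF f nf this] obtain k m where km:
    "k \<in> borel_measurable \<mu>" "m \<in> borel_measurable \<mu>" "\<And>a. cmod (k a) = 1" "\<And>a. cmod (m a) = 1"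
    "AE a in \<mu>. AE q in \<mu>. f (q, orb a) = k a * m (- q + a)"
    by blast
  note [measurable] = km(1,2)
  from cob_V_invariant[OF c km(1-4) nc cob_relation[OF f km(1-4) nc km(5) rel]]
  obtain \<rho> where \<rho> [measurable]: "\<rho> \<in> borel_measurable \<mu>" and nr: "\<And>d. cmod (\<rho> d) = 1"
    and V: "AE a in \<mu>. AE b in \<mu>. cob_V c k a b = \<rho> (- a + b)"
    by blast
  \<comment> \<open>Chosen so that \<open>l (- up a) = k a\<close> almost everywhere; twisting
    \<open>c\<close> by the coboundary of \<open>l\<close> then reproduces \<open>cob_V\<close>
    exactly.\<close>
  define l where "l x = k (down (- x))" for x
  have [measurable]: "l \<in> borel_measurable \<mu>" unfolding l_def by measurable
  have nl: "cmod (l x) = 1" for x by (simp add: l_def km(3))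
  have nz: "l x \<noteq> 0" "\<rho> x \<noteq> 0" for x using nl[of x] nr[of x] by auto
  define c1 where "c1 p = c p * (l (fst p) * l (snd p) / l (fst p + snd p))" for p
  have coc1: "c1 (x, y) * c1 (x + y, z) = c1 (y, z) * c1 (x, y + z)" for x y z
    using coc[of x y z] by (simp add: c1_def nz field_simps add.assoc)
  have "AE a in \<mu>. AE b in \<mu>. c1 (- up b + up a, - up a) = \<rho> (- a + b)"
    using V AE_down_up
  proof eventually_elim
    case a: (elim a)
    from a(1) AE_down_up show ?case
      by eventually_elim
        (simp add: c1_def l_def cob_V_def a(2) minus_add add.assoc mult_ac
          del: add_uminus_conv_diff uminus_add_conv_diff)
  qed
  from AE_coboundary[OF coc1 nr this]
  have c1: "AE y in \<mu>. AE x in \<mu>. c1 (x, y) = \<rho> (- x) * \<rho> (- y) / \<rho> (- (x + y))" .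
  define s where "s x = \<rho> (- x) / l x" for x
  have [measurable]: "s \<in> borel_measurable \<mu>" unfolding s_def by measurable
  have ns: "cmod (s x) = 1" for x by (simp add: s_def nl nr norm_divide)
  have nzs: "s x \<noteq> 0" for x using ns[of x] by auto
  \<comment> \<open>Dividing out the coboundary of \<open>s\<close> leaves a cocycle that equals 1
    almost everywhere, hence an exact coboundary.\<close>
  define e where "e p = c p * (s (fst p + snd p) / (s (fst p) * s (snd p)))" for p
  have "\<exists>b \<in> borel_measurable \<mu>. (\<forall>q. cmod (b q) = 1) \<and> (\<forall>x y. e (x, y) = b x * b y / b (x + y))"
  proof (rule Q.AE_trivial_cocycle_imp_coboundary)
    show "e \<in> borel_measurable (\<mu> \<Otimes>\<^sub>M \<mu>)" unfolding e_def by measurable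
    show "cmod (e p) = 1" for p by (simp add: e_def ns nc norm_mult norm_divide)
    show "e (x, y) * e (x + y, z) = e (y, z) * e (x, y + z)" for x y z
      using coc[of x y z] by (simp add: e_def nzs field_simps add.assoc)
    show "AE y in \<mu>. AE x in \<mu>. e (x, y) = 1"
      using c1
    proof eventually_elim
      case (elim y)
      then show ?case
        by eventually_elim (simp add: e_def c1_def s_def nz field_simps)
    qed
  qed
  then obtain b where b: "b \<in> borel_measurable \<mu>" "\<And>q. cmod (b q) = 1"
    "\<And>x y. e (x, y) = b x * b y / b (x + y)"
    by blast
  show ?thesis
  proof (intro bexI[of _ "\<lambda>x. b x * s x"] conjI allI)
    show "c (x, y) = b x * s x * (b y * s y) / (b (x + y) * s (x + y))" for x y
    proof -
      have "c (x, y) = e (x, y) * (s x * s y / s (x + y))" by (simp add: e_def nzs)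
      then show ?thesis by (simp add: b(3))
    qed
  qed (use b in \<open>auto simp: norm_mult ns\<close>)
qed

end

section \<open>Iterated quantifiers on products and the converse implication\<close>

lemma borel_measurable_cnj [measurable (raw)]:
  "f \<in> borel_measurable M \<Longrightarrow> (\<lambda>x. cnj (f x)) \<in> borel_measurable M"
  by (erule measurable_compose) (intro borel_measurable_continuous_onI continuous_intros)

text \<open>The condition says that a section of the exceptional set has measure zero, and the
  measure of sections is a measurable function.\<close>

lemma (in sigma_finite_measure) measurable_pred_AE:
  assumes [measurable]: "Measurable.pred (N \<Otimes>\<^sub>M M) Q"
  shows "Measurable.pred N (\<lambda>x. AE y in M. Q (x, y))"
proof -
  define A where "A = {p \<in> space (N \<Otimes>\<^sub>M M). \<not> Q p}"
  have A [measurable]: "A \<in> sets (N \<Otimes>\<^sub>M M)" unfolding A_def by measurable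
  have "{x \<in> space N. AE y in M. Q (x, y)} = {x \<in> space N. emeasure M (Pair x -` A) = 0}"
  proof (intro Collect_cong conj_cong refl)
    fix x assume x: "x \<in> space N"
    have "{y \<in> space M. \<not> Q (x, y)} = Pair x -` A"
      using x by (auto simp: A_def space_pair_measure)
    then show "(AE y in M. Q (x, y)) \<longleftrightarrow> emeasure M (Pair x -` A) = 0"
      using sets_Pair1[OF A] by (subst AE_iff_measurable[of "Pair x -` A"]) simp_all
  qed
  also have "\<dots> \<in> sets N"
    using measurable_emeasure_Pair[OF A] by measurable
  finally show ?thesis by (simp add: pred_def)
qed

context essentially_bijective_coboundary
begin

lemma AE_pair_pair_iff:
  assumes Q [measurable]: "Measurable.pred ((\<mu> \<Otimes>\<^sub>M \<nu>) \<Otimes>\<^sub>M (\<mu> \<Otimes>\<^sub>M \<nu>)) Q"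
  shows "(AE t in (\<mu> \<Otimes>\<^sub>M \<nu>) \<Otimes>\<^sub>M (\<mu> \<Otimes>\<^sub>M \<nu>). Q t) \<longleftrightarrow>
    (AE q in \<mu>. AE x in \<nu>. AE p in \<mu>. AE y in \<nu>. Q ((q, x), (p, y)))"
proof -
  interpret P: pair_sigma_finite \<mu> \<nu>
    by (rule pair_sigma_finite.intro) unfold_locales
  have M: "sigma_finite_measure (\<mu> \<Otimes>\<^sub>M \<nu>)"
    by (rule sigma_finite_pair_measure) unfold_locales
  interpret PP: pair_sigma_finite "\<mu> \<Otimes>\<^sub>M \<nu>" "\<mu> \<Otimes>\<^sub>M \<nu>"
    by (rule pair_sigma_finite.intro[OF M M])
  have split: "(AE t in \<mu> \<Otimes>\<^sub>M \<nu>. R t) \<longleftrightarrow> (AE q in \<mu>. AE x in \<nu>. R (q, x))"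
    if R: "Measurable.pred (\<mu> \<Otimes>\<^sub>M \<nu>) R" for R
    using P.AE_pair_iff[of "\<lambda>q x. R (q, x)"] R by (simp add: pred_def)
  have "Measurable.pred (\<mu> \<Otimes>\<^sub>M \<nu>) (\<lambda>u. Q (t, u))" for t
    using measurable_compose[OF measurable_Pair1' Q, of t] by (simp add: space_pair_measure)
  moreover have "Measurable.pred (\<mu> \<Otimes>\<^sub>M \<nu>) (\<lambda>t. AE u in \<mu> \<Otimes>\<^sub>M \<nu>. Q (t, u))"
    by (rule sigma_finite_measure.measurable_pred_AE[OF M Q])
  ultimately show ?thesis
    using PP.AE_pair_iff[of "\<lambda>t u. Q (t, u)"] Q by (simp add: pred_def split)
qed

text \<open>This makes the map on classes well defined. The function \<open>f\<close> is read off
  from the factors of \<open>\<theta>_c\<close> containing \<open>(p, y)\<close>. The dependence on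
  \<open>q\<close> cancels between \<open>f (q, x)\<close> and \<open>f (p + q, act p x)\<close>,
  and the last factor supplies the mixed terms.\<close>

lemma coboundary_imp_pent_coboundary:
  fixes b :: "'q \<Rightarrow> complex" and f :: "'q \<times> 'w \<Rightarrow> complex"
  assumes nb: "\<And>q. cmod (b q) = 1"
    and c: "\<And>x y. c (x, y) = b x * b y / b (x + y)"
    and f: "\<And>q x. f (q, x) = b (- \<zeta> (act (- q) x)) * cnj (b (- \<zeta> x))"
  shows "AE q in \<mu>. AE x in \<nu>. AE p in \<mu>. AE y in \<nu>.
      cnj (c (- \<zeta> (act (- p) y) + \<zeta> x, - \<zeta> x)) * c (- \<zeta> y + \<zeta> (act p x), - \<zeta> (act p x)) =
      f (q, x) * f (p, y) / (f (p + q, act p x) *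
        f (- \<zeta> (\<eta> (- p) + x) + \<zeta> x, act (- \<zeta> (\<eta> (- p) + x)) (act (- p) y - x)))"
proof (rule AE_I2)
  fix q
  have g1: "AE p in \<mu>. good (\<eta> (- p) + x)" for x
    by (rule Q.AE_minus, rule AE_eta, rule W.AE_add_right, rule AE_good)
  \<comment> \<open>Only \<open>p\<close> varies, so \<open>x\<close> must lie on the orbit of
    \<open>\<xi>0\<close>; goodness of \<open>x - \<xi>0\<close> ensures this.\<close>
  have g2: "AE p in \<mu>. good (act p x)" if "good (x - \<xi>0)" for x
  proof -
    have "x = orb (\<zeta> (x - \<xi>0))" using that by (simp add: orb_eq_eta good_def)
    then show ?thesis using Q.AE_add_right[OF AE_good_orb, of "\<zeta> (x - \<xi>0)"] by (simp add: act_add)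
  qed
  have g3: "AE y in \<nu>. good (act r (act p y - x))" for r p x
    unfolding diff_conv_add_uminus by (rule AE_act, rule W.AE_add_right, rule AE_act, rule AE_good)
  have g4: "AE x in \<nu>. good (x - \<xi>0)"
    using W.AE_add_right[OF AE_good, of "- \<xi>0"] by simp
  note grp = minus_add add.assoc
  show "AE x in \<nu>. AE p in \<mu>. AE y in \<nu>.
      cnj (c (- \<zeta> (act (- p) y) + \<zeta> x, - \<zeta> x)) * c (- \<zeta> y + \<zeta> (act p x), - \<zeta> (act p x)) =
      f (q, x) * f (p, y) / (f (p + q, act p x) *
        f (- \<zeta> (\<eta> (- p) + x) + \<zeta> x, act (- \<zeta> (\<eta> (- p) + x)) (act (- p) y - x)))"
    using AE_good g4
  proof eventually_elim
    case x: (elim x)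
    from g1[of x] g2[OF x(2)] show ?case
    proof eventually_elim
      case p: (elim p)
      let ?r = "\<zeta> (\<eta> (- p) + x)"
      from AE_good AE_act[OF AE_good, of "- p"] g3[of "- ?r" "- p" x] g3[of "- \<zeta> x" "- p" x]
      show ?case
      proof eventually_elim
        case y: (elim y)
        define s where "s = \<zeta> x"
        define r where "r = ?r"
        define by' where "by' = \<zeta> y"
        define bz where "bz = \<zeta> (act (- p) y)"
        have s: "\<eta> s = x" and r: "\<eta> r = \<eta> (- p) + x" and by': "\<eta> by' = y" and bz: "\<eta> bz = act (- p) y"
          using x p y by (auto simp: good_def s_def r_def by'_def bz_def)
        have t: "\<zeta> (act p x) = p + r"
          using p(2) eta_add[of p "- p"]
          by (intro zeta_eqI) (simp_all add: eta_add r act_plus eta_zero)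
        have z1: "\<zeta> (act (- r) (act (- p) y - x)) = - (p + r) + by'"
        proof (rule zeta_eqI)
          show "good (act (- r) (act (- p) y - x))" using y(3) by (simp add: r_def)
          have "\<eta> (p + r) = act p x"
            using p(2) by (simp add: t[symmetric] good_def)
          then have "\<eta> (- (p + r) + by') = - act (- (p + r)) (act p x) + act (- (p + r)) y"
            by (simp only: eta_add[of "- (p + r)"] eta_uminus[of "p + r"] by')
          then show "\<eta> (- (p + r) + by') = act (- r) (act (- p) y - x)"
            by (simp add: grp act_add act_minus del: add_uminus_conv_diff)
        qed
        have z2: "\<zeta> (act (- (- r + s)) (act (- r) (act (- p) y - x))) = - s + bz"
        proof (rule zeta_eqI)
          have eq: "act (- (- r + s)) (act (- r) (act (- p) y - x)) = act (- s) (act (- p) y - x)"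
            by (simp add: grp act_add del: add_uminus_conv_diff uminus_add_conv_diff)
          show "good (act (- (- r + s)) (act (- r) (act (- p) y - x)))"
            unfolding eq using y(4) by (simp add: s_def)
          show "\<eta> (- s + bz) = act (- (- r + s)) (act (- r) (act (- p) y - x))"
            unfolding eq by (simp add: eta_add eta_uminus s bz act_minus
                del: add_uminus_conv_diff uminus_add_conv_diff)
        qed
        have z3: "act (- (p + q)) (act p x) = act (- q) x"
          by (simp add: grp act_add del: add_uminus_conv_diff)
        have nz: "b q \<noteq> 0" for q using nb[of q] by auto
        have cc: "cnj (b q) = 1 / b q" for q
          using nb[of q] nz[of q] by (simp add: divide_conv_cnj)
        have i: "(- by' + (p + r)) + - (p + r) = - by'" "(- bz + s) + - s = - bz"
          by (simp_all add: grp del: add_uminus_conv_diff uminus_add_conv_diff)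
        show ?case
          unfolding s_def[symmetric] r_def[symmetric] by'_def[symmetric] bz_def[symmetric] f t z1 z2 z3 c i
          by (simp add: cc nz grp field_simps del: add_uminus_conv_diff uminus_add_conv_diff)
      qed
    qed
  qed
qed

end

section \<open>The map on cohomology\<close>

lemma pent_coset_eq: "A #>\<^bsub>pent_Z2 M w\<^esub> t = (\<lambda>s p. s p * t p) ` A"
  by (auto simp: r_coset_def pent_Z2_def)

lemma moore_coset_eq: "A #>\<^bsub>moore_Z2\<^esub> t = (\<lambda>s p. s p * t p) ` A"
  by (auto simp: r_coset_def moore_Z2_def)

lemma pent_B2_mult:
  assumes "s \<in> pent_B2 M w" "t \<in> pent_B2 M w"
  shows "(\<lambda>p. s p * t p) \<in> pent_B2 M w"
proof -
  from assms obtain f g where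
    [measurable]: "s \<in> borel_measurable (M \<Otimes>\<^sub>M M)" "t \<in> borel_measurable (M \<Otimes>\<^sub>M M)"
      "f \<in> borel_measurable M" "g \<in> borel_measurable M"
    and *: "\<forall>p. cmod (s p) = 1" "\<forall>p. cmod (t p) = 1" "\<forall>x. cmod (f x) = 1" "\<forall>x. cmod (g x) = 1"
      "AE p in M \<Otimes>\<^sub>M M. s p = (f (fst p) * f (snd p)) / (f (fst (w p)) * f (snd (w p)))"
      "AE p in M \<Otimes>\<^sub>M M. t p = (g (fst p) * g (snd p)) / (g (fst (w p)) * g (snd (w p)))"
    unfolding pent_B2_def by blast
  show ?thesis
    unfolding pent_B2_def
  proof (intro CollectI conjI bexI[of _ "\<lambda>x. f x * g x"])
    show "AE p in M \<Otimes>\<^sub>M M. s p * t p = f (fst p) * g (fst p) * (f (snd p) * g (snd p)) /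
        (f (fst (w p)) * g (fst (w p)) * (f (snd (w p)) * g (snd (w p))))"
      using *(5,6) by eventually_elim (simp add: mult_ac)
  qed (use * in \<open>auto simp: norm_mult\<close>)
qed

lemma pent_B2_cnj:
  assumes "s \<in> pent_B2 M w"
  shows "(\<lambda>p. cnj (s p)) \<in> pent_B2 M w"
proof -
  from assms obtain f where
    [measurable]: "s \<in> borel_measurable (M \<Otimes>\<^sub>M M)" "f \<in> borel_measurable M"
    and *: "\<forall>p. cmod (s p) = 1" "\<forall>x. cmod (f x) = 1"
      "AE p in M \<Otimes>\<^sub>M M. s p = (f (fst p) * f (snd p)) / (f (fst (w p)) * f (snd (w p)))"
    unfolding pent_B2_def by blast
  show ?thesis
    unfolding pent_B2_def
  proof (intro CollectI conjI bexI[of _ "\<lambda>x. cnj (f x)"])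
    show "AE p in M \<Otimes>\<^sub>M M. cnj (s p) =
        cnj (f (fst p)) * cnj (f (snd p)) / (cnj (f (fst (w p))) * cnj (f (snd (w p))))"
      using *(3) by eventually_elim simp
  qed (use * in \<open>measurable, auto\<close>)
qed

lemma pent_B2_one: "(\<lambda>_. 1) \<in> pent_B2 M w"
  unfolding pent_B2_def by (auto intro!: bexI[of _ "\<lambda>_. 1"])

lemma moore_B2_mult:
  assumes "s \<in> moore_B2" "t \<in> moore_B2"
  shows "(\<lambda>p. s p * t p) \<in> moore_B2"
proof -
  from assms obtain a b where "a \<in> borel_measurable borel" "b \<in> borel_measurable borel"
    "\<forall>q. cmod (a q) = 1" "\<forall>q. cmod (b q) = 1"
    "\<forall>x y. s (x, y) = a x * a y / a (x + y)" "\<forall>x y. t (x, y) = b x * b y / b (x + y)"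
    unfolding moore_B2_def by blast
  then show ?thesis
    unfolding moore_B2_def by (intro CollectI bexI[of _ "\<lambda>x. a x * b x"]) (auto simp: norm_mult)
qed

lemma moore_B2_cnj:
  assumes "s \<in> moore_B2"
  shows "(\<lambda>p. cnj (s p)) \<in> moore_B2"
proof -
  from assms obtain a where "a \<in> borel_measurable borel" "\<forall>q. cmod (a q) = 1"
    "\<forall>x y. s (x, y) = a x * a y / a (x + y)"
    unfolding moore_B2_def by blast
  then show ?thesis
    unfolding moore_B2_def by (intro CollectI bexI[of _ "\<lambda>x. cnj (a x)"]) auto
qed

lemma moore_B2_one: "(\<lambda>_. 1) \<in> moore_B2"
  unfolding moore_B2_def by (auto intro!: bexI[of _ "\<lambda>_. 1"])

lemma theta_mult: "theta \<alpha> \<zeta> (\<lambda>p. c p * d p) = (\<lambda>t. theta \<alpha> \<zeta> c t * theta \<alpha> \<zeta> d t)"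
  by (auto simp: theta_def fun_eq_iff)

lemma theta_cnj: "theta \<alpha> \<zeta> (\<lambda>p. cnj (c p)) = (\<lambda>t. cnj (theta \<alpha> \<zeta> c t))"
  by (auto simp: theta_def fun_eq_iff)

text \<open>Conjugation inverts unimodular functions, so multiplication by \<open>s\<close> permutes
  \<open>A\<close>. Stated for sets of functions, this serves the cosets of both cohomology
  theories.\<close>

lemma image_mult_absorb:
  fixes s t :: "'a \<Rightarrow> complex"
  assumes mult: "\<And>u v. u \<in> A \<Longrightarrow> v \<in> A \<Longrightarrow> (\<lambda>p. u p * v p) \<in> A"
    and cnj: "\<And>u. u \<in> A \<Longrightarrow> (\<lambda>p. cnj (u p)) \<in> A"
    and s: "s \<in> A" "\<And>p. cmod (s p) = 1"
  shows "(\<lambda>u p. u p * (s p * t p)) ` A = (\<lambda>u p. u p * t p) ` A"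
proof (intro equalityI image_subsetI)
  fix u assume u: "u \<in> A"
  show "(\<lambda>p. u p * (s p * t p)) \<in> (\<lambda>u p. u p * t p) ` A"
    using mult[OF u s(1)] by (intro image_eqI[of _ _ "\<lambda>p. u p * s p"]) (simp_all add: mult.assoc)
  have unit: "cnj (s p) * (s p * x) = x" for p x
    using s(2)[of p] complex_norm_square[of "s p"] by (simp add: mult.commute mult.left_commute)
  show "(\<lambda>p. u p * t p) \<in> (\<lambda>u p. u p * (s p * t p)) ` A"
  proof (rule image_eqI)
    show "(\<lambda>p. u p * t p) = (\<lambda>p. u p * cnj (s p) * (s p * t p))"
      by (simp only: mult.assoc unit)
  qed (rule mult[OF u cnj[OF s(1)]])
qed

theorem proposition3p7:
  fixes \<alpha> :: "'q::{topological_group_add, t2_space, second_countable_topology} \<Rightarrow>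
              'v::{topological_ab_group_add, t2_space, second_countable_topology} \<Rightarrow> 'v"
    and \<mu> :: "'q measure" and \<nu> :: "'v pdual measure"
    and \<eta> :: "'q \<Rightarrow> 'v pdual" and \<zeta> :: "'v pdual \<Rightarrow> 'q"
  assumes "locally_compact_space (euclidean :: 'q topology)"
    and "locally_compact_space (euclidean :: 'v topology)"
    and "continuous_action \<alpha>"
    and "haar_measure \<mu>" and "haar_measure \<nu>"
    and "\<eta> \<in> cocycles1 \<alpha>"
    and "measure_class_iso \<mu> \<nu> \<eta>"
    and "ae_inverse \<mu> \<nu> \<eta> \<zeta>"
    and "\<exists>\<xi>0. \<forall>q. \<eta> q = dual_act \<alpha> q \<xi>0 - \<xi>0"
  shows "inj_on (theta_H2 \<mu> \<nu> \<alpha> \<eta> \<zeta>) (carrier moore_H2)"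
proof -
  obtain \<xi>0 where \<xi>0: "\<And>q. \<eta> q = dual_act \<alpha> q \<xi>0 - \<xi>0" using assms(9) by blast
  have bq: "\<exists>B :: 'q set set. countable B \<and> topological_basis B"
    using ex_countable_basis by auto
  note bv = countable_basis_pdual[OF assms(2)]
  have sets_\<mu>: "sets \<mu> = sets borel" and sets_\<nu>: "sets \<nu> = sets borel"
    using assms(4,5) by (simp_all add: haar_measure_def)
  interpret essentially_bijective_coboundary \<mu> \<nu> "dual_act \<alpha>" \<xi>0 \<eta> \<zeta>
  proof (intro essentially_bijective_coboundary.intro essentially_bijective_coboundary_axioms.intro)
    show "measurable_group \<mu>" by (rule haar_measurable_group[OF bq assms(4)])
    show "measurable_group \<nu>" by (rule haar_measurable_group[OF bv assms(5)])
    show "(\<lambda>p. dual_act \<alpha> (fst p) (snd p)) \<in> \<mu> \<Otimes>\<^sub>M \<nu> \<rightarrow>\<^sub>M \<nu>"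
      using measurable_continuous_prod[OF bq bv continuous_dual_act[OF assms(2,3)]]
      by (simp cong: measurable_cong_sets sets_pair_measure_cong add: sets_\<mu> sets_\<nu>)
  qed (use assms(7,8) \<xi>0 in \<open>simp_all add: dual_act_add dual_act_zero dual_act_plus assms(3)\<close>)
  let ?M = "\<mu> \<Otimes>\<^sub>M \<nu>" and ?v = "pent_v \<alpha> \<eta> \<zeta>" and ?\<theta> = "theta \<alpha> \<zeta>"
  have borel_Q: "borel_measurable borel = (borel_measurable \<mu> :: ('q \<Rightarrow> complex) set)"
    by (rule measurable_cong_sets) (simp_all add: sets_\<mu>)
  have borel_QQ: "borel_measurable borel = (borel_measurable (\<mu> \<Otimes>\<^sub>M \<mu>) :: ('q \<times> 'q \<Rightarrow> complex) set)"
    unfolding borel_prod[symmetric]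
    by (rule measurable_cong_sets) (simp_all add: sets_\<mu> cong: sets_pair_measure_cong)
  have theta_measurable: "?\<theta> c \<in> borel_measurable (?M \<Otimes>\<^sub>M ?M)"
    if [measurable]: "c \<in> borel_measurable (\<mu> \<Otimes>\<^sub>M \<mu>)" for c
    unfolding theta_def split_beta by measurable
  have v_measurable: "?v \<in> ?M \<Otimes>\<^sub>M ?M \<rightarrow>\<^sub>M ?M \<Otimes>\<^sub>M ?M"
    unfolding pent_v_def split_beta by measurable
  have AE_theta: "(AE t in ?M \<Otimes>\<^sub>M ?M. ?\<theta> c t = f (fst t) * f (snd t) / (f (fst (?v t)) * f (snd (?v t)))) \<longleftrightarrow>
      (AE q in \<mu>. AE x in \<nu>. AE p in \<mu>. AE y in \<nu>.
        cnj (c (- \<zeta> (dual_act \<alpha> (- p) y) + \<zeta> x, - \<zeta> x)) * c (- \<zeta> y + \<zeta> (dual_act \<alpha> p x), - \<zeta> (dual_act \<alpha> p x)) =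
        f (q, x) * f (p, y) / (f (p + q, dual_act \<alpha> p x) *
          f (- \<zeta> (\<eta> (- p) + x) + \<zeta> x, dual_act \<alpha> (- \<zeta> (\<eta> (- p) + x)) (dual_act \<alpha> (- p) y - x))))"
    if c: "c \<in> borel_measurable (\<mu> \<Otimes>\<^sub>M \<mu>)" and f [measurable]: "f \<in> borel_measurable ?M" for c f
  proof -
    note [measurable] = v_measurable theta_measurable[OF c]
    have "Measurable.pred (?M \<Otimes>\<^sub>M ?M)
        (\<lambda>t. ?\<theta> c t = f (fst t) * f (snd t) / (f (fst (?v t)) * f (snd (?v t))))"
      by (rule measurable_pred_eq_complex) measurable
    from AE_pair_pair_iff[OF this] show ?thesis by (simp add: theta_def pent_v_def)
  qed
  have moore_imp_pent: "?\<theta> c \<in> pent_B2 ?M ?v" if "c \<in> moore_B2" for c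
  proof -
    from that obtain b where b: "b \<in> borel_measurable \<mu>" "\<And>q. cmod (b q) = 1"
      "\<And>x y. c (x, y) = b x * b y / b (x + y)"
      unfolding moore_B2_def borel_Q by blast
    note [measurable] = b(1)
    have "c = (\<lambda>p. b (fst p) * b (snd p) / b (fst p + snd p))" using b(3) by (auto simp: fun_eq_iff)
    then have c: "c \<in> borel_measurable (\<mu> \<Otimes>\<^sub>M \<mu>)" by simp
    define f where "f p = b (- \<zeta> (dual_act \<alpha> (- fst p) (snd p))) * cnj (b (- \<zeta> (snd p)))" for p
    have f: "f \<in> borel_measurable ?M" unfolding f_def by measurable
    have "AE t in ?M \<Otimes>\<^sub>M ?M. ?\<theta> c t = f (fst t) * f (snd t) / (f (fst (?v t)) * f (snd (?v t)))"
      unfolding AE_theta[OF c f] by (rule coboundary_imp_pent_coboundary[OF b(2,3)]) (simp add: f_def)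
    moreover have "cmod (?\<theta> c t) = 1" for t
      by (simp add: theta_def split_beta norm_mult norm_divide b(2,3))
    moreover have "cmod (f p) = 1" for p by (simp add: f_def norm_mult b(2))
    ultimately show ?thesis
      unfolding pent_B2_def using theta_measurable[OF c] f by blast
  qed
  have pent_imp_moore: "c \<in> moore_B2" if c: "c \<in> carrier moore_Z2" and p: "?\<theta> c \<in> pent_B2 ?M ?v" for c
  proof -
    have c': "c \<in> borel_measurable (\<mu> \<Otimes>\<^sub>M \<mu>)" "\<And>p. cmod (c p) = 1"
      "\<And>x y z. c (x, y) * c (x + y, z) = c (y, z) * c (x, y + z)"
      using c by (simp_all add: moore_Z2_def borel_QQ del: split_paired_All)
    from p obtain f where f: "f \<in> borel_measurable ?M" "\<And>x. cmod (f x) = 1"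
      and ae: "AE t in ?M \<Otimes>\<^sub>M ?M. ?\<theta> c t = f (fst t) * f (snd t) / (f (fst (?v t)) * f (snd (?v t)))"
      unfolding pent_B2_def by blast
    from pent_coboundary_imp_coboundary[OF f c' ae[unfolded AE_theta[OF c'(1) f(1)]]]
    show ?thesis unfolding moore_B2_def borel_Q by blast
  qed
  have norm_theta: "cmod (?\<theta> c t) = 1" if "\<And>p. cmod (c p) = 1" for c t
    by (simp add: theta_def split_beta norm_mult that)
  have norm_B2: "cmod (b p) = 1" if "b \<in> moore_B2" for b :: "'q \<times> 'q \<Rightarrow> complex" and p
    using that unfolding moore_B2_def by (cases p) (auto simp: norm_mult norm_divide)
  have pent_absorb: "(\<lambda>u p. u p * (s p * t p)) ` pent_B2 ?M ?v = (\<lambda>u p. u p * t p) ` pent_B2 ?M ?v"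
    if "s \<in> pent_B2 ?M ?v" "\<And>p. cmod (s p) = 1" for s t
    by (rule image_mult_absorb[OF pent_B2_mult pent_B2_cnj that])
  have moore_absorb: "(\<lambda>u p. u p * (s p * t p)) ` moore_B2 = (\<lambda>u p. u p * t p) ` moore_B2"
    if "s \<in> moore_B2" for s t :: "'q \<times> 'q \<Rightarrow> complex"
    by (rule image_mult_absorb[OF moore_B2_mult moore_B2_cnj that norm_B2[OF that]])
  \<comment> \<open>Representatives differ by Moore coboundaries, which \<open>?\<theta>\<close>
    sends to pentagonal ones. The image is thus a singleton and \<open>the_elem\<close> returns its
    element.\<close>
  have theta_H2_coset: "theta_H2 \<mu> \<nu> \<alpha> \<eta> \<zeta> (moore_B2 #>\<^bsub>moore_Z2\<^esub> c) = (\<lambda>s p. s p * ?\<theta> c p) ` pent_B2 ?M ?v" for c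
  proof -
    have "(\<lambda>s p. s p * ?\<theta> (\<lambda>p. b p * c p) p) ` pent_B2 ?M ?v = (\<lambda>s p. s p * ?\<theta> c p) ` pent_B2 ?M ?v"
      if "b \<in> moore_B2" for b
      unfolding theta_mult
      by (rule pent_absorb[OF moore_imp_pent[OF that] norm_theta[OF norm_B2[OF that]]])
    moreover have "(moore_B2 :: ('q \<times> 'q \<Rightarrow> complex) set) \<noteq> {}" using moore_B2_one by blast
    ultimately have "(\<lambda>c. (\<lambda>s p. s p * ?\<theta> c p) ` pent_B2 ?M ?v) ` (\<lambda>b p. b p * c p) ` moore_B2 =
        {(\<lambda>s p. s p * ?\<theta> c p) ` pent_B2 ?M ?v}"
      unfolding image_image by (simp add: image_constant_conv cong: image_cong)
    then show ?thesis
      unfolding theta_H2_def moore_coset_eq pent_coset_eq by simp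
  qed
  show ?thesis
  proof (rule inj_onI)
    fix C D assume "C \<in> carrier moore_H2" "D \<in> carrier moore_H2"
      and eq: "theta_H2 \<mu> \<nu> \<alpha> \<eta> \<zeta> C = theta_H2 \<mu> \<nu> \<alpha> \<eta> \<zeta> D"
    then obtain c d where c: "c \<in> carrier moore_Z2" "C = moore_B2 #>\<^bsub>moore_Z2\<^esub> c"
      and d: "d \<in> carrier moore_Z2" "D = moore_B2 #>\<^bsub>moore_Z2\<^esub> d"
      by (auto simp: moore_H2_def FactGroup_def RCOSETS_def)
    have n: "\<And>p. cmod (c p) = 1" "\<And>p. cmod (d p) = 1" using c(1) d(1) by (simp_all add: moore_Z2_def del: split_paired_All)
    \<comment> \<open>The quotient of the two cocycles: equality of the images makes
      \<open>?\<theta> e\<close> a pentagonal coboundary.\<close>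
    define e where "e = (\<lambda>p. c p * cnj (d p))"
    have unit: "z * cnj z = 1" if "cmod z = 1" for z
      using complex_norm_square[of z] that by simp
    have "(\<lambda>p. 1 * ?\<theta> c p) \<in> (\<lambda>s p. s p * ?\<theta> c p) ` pent_B2 ?M ?v"
      by (rule image_eqI[OF _ pent_B2_one]) simp
    then have "?\<theta> c \<in> (\<lambda>s p. s p * ?\<theta> d p) ` pent_B2 ?M ?v"
      using eq by (simp add: c(2) d(2) theta_H2_coset)
    then obtain s where s: "s \<in> pent_B2 ?M ?v" "?\<theta> c = (\<lambda>p. s p * ?\<theta> d p)" by blast
    then have "?\<theta> e = s"
      unfolding e_def theta_mult theta_cnj by (simp add: fun_eq_iff mult.assoc unit norm_theta n(2))
    moreover have "e \<in> carrier moore_Z2"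
    proof -
      have m [measurable]: "c \<in> borel_measurable borel" "d \<in> borel_measurable borel"
        and coc: "c (x, y) * c (x + y, z) = c (y, z) * c (x, y + z)"
          "d (x, y) * d (x + y, z) = d (y, z) * d (x, y + z)" for x y z
        using c(1) d(1) by (simp_all add: moore_Z2_def)
      have "e (x, y) * e (x + y, z) = e (y, z) * e (x, y + z)" for x y z
      proof -
        have "e (x, y) * e (x + y, z) = (c (x, y) * c (x + y, z)) * cnj (d (x, y) * d (x + y, z))"
          by (simp add: e_def)
        then show ?thesis unfolding coc by (simp add: e_def)
      qed
      then show ?thesis
        using n by (simp add: moore_Z2_def e_def norm_mult)
    qed
    ultimately have "e \<in> moore_B2" using pent_imp_moore s(1) by blast
    moreover have "c = (\<lambda>p. e p * d p)"
      by (simp add: e_def fun_eq_iff mult.assoc mult.commute[of "cnj _"] unit n(2))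
    ultimately show "C = D"
      unfolding c(2) d(2) moore_coset_eq using moore_absorb[of e d] by simp
  qed
qed

end
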